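(* Any streaming algorithm that uses $\mathrm{polylog}(n)$ passes and, for every $n$-vertex graph $G$, estimates the value $\mathrm{OPT}(G)$ to within an approximation ratio of $o\!\left(\frac{\log n}{\log\log n}\right)$ (with constant success probability) requires $\Omega(n/\mathrm{polylog}(n))$ space.
   Context: For an $n$-vertex graph $G=(V,E)$ (unit edge weights), a hierarchical clustering tree (HC-tree) is a rooted tree whose leaves are in bijection with $V$; its cost is $C_G(\mathcal T)=\sum_{(u,v)\in E}|\mathrm{leaves}(\mathcal T[u\vee v])|$, where $u\vee v$ is the lowest common ancestor of $u,v$ and $\mathrm{leaves}(\mathcal T[z])$ is the leaf set of the subtree rooted at $z$; $\mathrm{OPT}(G)$ is the minimum cost over HC-trees. Estimating within ratio $\alpha$ means outputting a number $\hat z$ with $\mathrm{OPT}(G)\le\hat z\le\alpha\cdot\mathrm{OPT}(G)$. Streaming model: the edges of $G$ arrive in an arbitrary order; a $p$-pass algorithm reads the edge sequence $p$ times; space is the maximum memory used. *)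

theory Defs
  imports "HOL-Probability.Probability" "HOL-Library.Landau_Symbols"
begin

definition graph_on :: "nat \<Rightarrow> nat set set \<Rightarrow> bool" where
  "graph_on n E \<longleftrightarrow> (\<forall>e\<in>E. \<exists>u v. e = {u, v} \<and> u \<noteq> v \<and> u < n \<and> v < n)"

datatype hct = Leaf nat | Node "hct list"

fun leaves :: "hct \<Rightarrow> nat set" where
  "leaves (Leaf v) = {v}"
| "leaves (Node ts) = (\<Union>t\<in>set ts. leaves t)"

fun leaf_list :: "hct \<Rightarrow> nat list" where
  "leaf_list (Leaf v) = [v]"
| "leaf_list (Node ts) = concat (map leaf_list ts)"

fun subtrees :: "hct \<Rightarrow> hct set" where
  "subtrees (Leaf v) = {Leaf v}"
| "subtrees (Node ts) = insert (Node ts) (\<Union>t\<in>set ts. subtrees t)"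

definition hc_tree :: "nat \<Rightarrow> hct \<Rightarrow> bool" where
  "hc_tree n T \<longleftrightarrow> distinct (leaf_list T) \<and> set (leaf_list T) = {0..<n}"

definition lca_subtree :: "hct \<Rightarrow> nat \<Rightarrow> nat \<Rightarrow> hct" where
  "lca_subtree T u v =
     (ARG_MIN (\<lambda>S. card (leaves S)) S. S \<in> subtrees T \<and> u \<in> leaves S \<and> v \<in> leaves S)"

definition hc_cost :: "nat set set \<Rightarrow> hct \<Rightarrow> nat" where
  "hc_cost E T = (\<Sum>(u, v)\<in>{(u, v). {u, v} \<in> E \<and> u < v}. card (leaves (lca_subtree T u v)))"

definition OPT :: "nat \<Rightarrow> nat set set \<Rightarrow> nat" where
  "OPT n E = (LEAST c. \<exists>T. hc_tree n T \<and> hc_cost E T = c)"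

definition edge_stream :: "nat set set \<Rightarrow> (nat \<times> nat) list \<Rightarrow> bool" where
  "edge_stream E xs \<longleftrightarrow> distinct (map (\<lambda>(u, v). {u, v}) xs)
      \<and> set (map (\<lambda>(u, v). {u, v}) xs) = E"

text \<open>A deterministic multi-pass streaming algorithm whose memory is a bit string:
  initial memory, update (pass index, memory, edge) and output function.\<close>
record salg =
  s_init :: "bool list"
  s_upd :: "nat \<Rightarrow> bool list \<Rightarrow> nat \<times> nat \<Rightarrow> bool list"
  s_out :: "bool list \<Rightarrow> real"

definition uses_space :: "nat \<Rightarrow> salg \<Rightarrow> bool" where
  "uses_space s A \<longleftrightarrow> length (s_init A) \<le> s
     \<and> (\<forall>i m e. length (s_upd A i m e) \<le> s)"

fun run_passes :: "salg \<Rightarrow> (nat \<times> nat) list \<Rightarrow> nat \<Rightarrow> bool list" where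
  "run_passes A xs 0 = s_init A"
| "run_passes A xs (Suc i) = foldl (s_upd A i) (run_passes A xs i) xs"

definition stream_output :: "salg \<Rightarrow> nat \<Rightarrow> (nat \<times> nat) list \<Rightarrow> real" where
  "stream_output A p xs = s_out A (run_passes A xs p)"

text \<open>A randomized algorithm: a distribution over deterministic algorithms (random tape).
  It is a p-pass, space-s algorithm estimating OPT within ratio alpha with success
  probability at least 2/3 on every n-vertex graph and every edge order.\<close>
definition estimates_OPT ::
  "nat \<Rightarrow> nat \<Rightarrow> nat \<Rightarrow> real \<Rightarrow> salg pmf \<Rightarrow> bool" where
  "estimates_OPT n p s alpha R \<longleftrightarrow>
     (\<forall>A\<in>set_pmf R. uses_space s A) \<and>
     (\<forall>E xs. graph_on n E \<longrightarrow> edge_stream E xs \<longrightarrow>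
        measure_pmf.prob R {A. real (OPT n E) \<le> stream_output A p xs
                               \<and> stream_output A p xs \<le> alpha * real (OPT n E)} \<ge> 2/3)"

end

theory Submission
  imports Defs "HOL-Real_Asymp.Real_Asymp"
begin

text \<open>
  The bound is a reduction from the inner product modulo 2 of two sets \<open>x, y \<subseteq> {..<N}\<close>. A hub vertex
  is the start of \<open>m\<close> wires, each carrying two parallel tracks through \<open>N\<close> layers; layer \<open>i\<close> exchanges
  the tracks iff \<open>i \<in> x \<inter> y\<close>, and the far end of one fixed track leads to a path of \<open>K\<close> vertices,
  the block of the wire. If \<open>card (x \<inter> y)\<close> is even, the hub is joined to all \<open>m\<close> blocks, and every
  balanced cut of this spider has about \<open>m\<close> edges, so \<open>OPT\<close> is at least \<open>m\<^sup>2 K / 4\<close>.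
  If it is odd, hub and blocks lie in different components; as the wires are short, \<open>OPT\<close>
  is dominated by the disjoint paths and is \<open>O(m K log n)\<close>. With \<open>m\<close> of order \<open>(log n)\<^sup>2\<close> this gap
  exceeds the approximation ratio while \<open>N\<close> is still \<open>n / polylog n\<close>.

  The layers are built from edges depending only on \<open>x\<close> (streamed first) and edges depending only on
  \<open>y\<close>. A \<open>p\<close>-pass algorithm with \<open>s\<close> bits therefore yields a two-party protocol with
  at most \<open>2\<^bsup>2p(s+1)\<^esup>\<close> transcripts, each consistent with a combinatorial rectangle of inputs.
  Lindsey's lemma bounds the discrepancy of the inner product on rectangles, whence \<open>N \<le> 4p(s+1) + 4\<close>.
\<close>

section \<open>Cost of hierarchical clustering trees\<close>

lemma set_leaf_list: "set (leaf_list T) = leaves T"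
  by (induction T) auto

lemma finite_leaves: "finite (leaves T)"
  unfolding set_leaf_list[symmetric] by simp

lemma self_in_subtrees: "T \<in> subtrees T"
  by (cases T) auto

lemma leaves_subtree_subset: "S \<in> subtrees T \<Longrightarrow> leaves S \<subseteq> leaves T"
  by (induction T) fastforce+

lemma Leaf_in_subtrees: "v \<in> leaves T \<Longrightarrow> Leaf v \<in> subtrees T"
  by (induction T) auto

lemma disjoint_concat_map:
  assumes "distinct (concat (map f xs))" "x \<in> set xs" "y \<in> set xs" "x \<noteq> y"
  shows "set (f x) \<inter> set (f y) = {}"
  using assms by (induction xs) auto

lemma distinct_concat_mapD:
  assumes "distinct (concat (map f xs))" "x \<in> set xs"
  shows "distinct (f x)"
  using assms by (induction xs) auto

text \<open>Leaf labels do not repeat, so subtrees of different children have disjoint leaf sets;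
  within one child the induction hypothesis applies.\<close>

lemma subtrees_laminar:
  assumes "distinct (leaf_list T)" "S \<in> subtrees T" "S' \<in> subtrees T"
  shows "leaves S \<subseteq> leaves S' \<or> leaves S' \<subseteq> leaves S \<or> leaves S \<inter> leaves S' = {}"
  using assms
proof (induction T)
  case (Leaf v)
  then show ?case by auto
next
  case (Node ts)
  show ?case
  proof (cases "S = Node ts \<or> S' = Node ts")
    case True
    then show ?thesis using Node.prems leaves_subtree_subset by blast
  next
    case False
    then obtain t t' where t: "t \<in> set ts" "S \<in> subtrees t" "t' \<in> set ts" "S' \<in> subtrees t'"
      using Node.prems by auto
    show ?thesis
    proof (cases "t = t'")
      case True
      have "distinct (leaf_list t)"
        using distinct_concat_mapD[of leaf_list ts t] Node.prems t by simp
      then show ?thesis using Node.IH[of t] t True by blast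
    next
      case False
      then have "leaves t \<inter> leaves t' = {}"
        using disjoint_concat_map[of leaf_list ts t t'] Node.prems t by (simp add: set_leaf_list)
      then show ?thesis using leaves_subtree_subset t by blast
    qed
  qed
qed

text \<open>The minimum is over cardinalities because \<open>lca_subtree\<close> chooses arbitrarily
  among minimizers (a node with a single child ties with that child), while the number of leaves is
  unambiguous. The value is meaningful when \<open>e\<close> lies within the leaves of
  \<open>T\<close>.\<close>

definition ecost :: "hct \<Rightarrow> nat set \<Rightarrow> nat" where
  "ecost T e = (LEAST c. \<exists>S\<in>subtrees T. e \<subseteq> leaves S \<and> c = card (leaves S))"

lemma ecost_le: "S \<in> subtrees T \<Longrightarrow> e \<subseteq> leaves S \<Longrightarrow> ecost T e \<le> card (leaves S)"
  unfolding ecost_def by (rule Least_le) auto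

lemma ecost_attained:
  assumes "e \<subseteq> leaves T"
  obtains S where "S \<in> subtrees T" "e \<subseteq> leaves S" "ecost T e = card (leaves S)"
proof -
  have "\<exists>c. \<exists>S\<in>subtrees T. e \<subseteq> leaves S \<and> c = card (leaves S)"
    using assms self_in_subtrees by blast
  from LeastI_ex[OF this] show ?thesis
    using that unfolding ecost_def by blast
qed

lemma ecost_mono_subtree:
  assumes "T' \<in> subtrees T" "subtrees T' \<subseteq> subtrees T" "e \<subseteq> leaves T'"
  shows "ecost T e \<le> ecost T' e"
  using ecost_attained[OF assms(3)] ecost_le assms(2) by (metis subsetD)

lemma card_lca_subtree:
  assumes "u \<in> leaves T" "v \<in> leaves T"
  shows "card (leaves (lca_subtree T u v)) = ecost T {u, v}"
proof -
  let ?P = "\<lambda>S. S \<in> subtrees T \<and> u \<in> leaves S \<and> v \<in> leaves S"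
  have PT: "?P T" using assms self_in_subtrees by blast
  have P: "?P (lca_subtree T u v)"
    unfolding lca_subtree_def by (rule arg_min_natI[of ?P T, OF PT])
  have le: "card (leaves (lca_subtree T u v)) \<le> card (leaves S)" if "?P S" for S
    unfolding lca_subtree_def by (rule arg_min_nat_le[of ?P S, OF that])
  obtain S where S: "S \<in> subtrees T" "{u, v} \<subseteq> leaves S" "ecost T {u, v} = card (leaves S)"
    using ecost_attained[of "{u, v}" T] assms by blast
  show ?thesis
    using le[of S] S ecost_le[of "lca_subtree T u v" T "{u, v}"] P by (simp add: antisym)
qed

lemma graph_on_finite:
  assumes "graph_on n E"
  shows "finite E"
proof (rule finite_subset)
  show "E \<subseteq> Pow {0..<n}" using assms unfolding graph_on_def by fastforce
qed simp

lemma graph_onE: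
  assumes "graph_on n E" "e \<in> E"
  obtains u v where "e = {u, v}" "u < v" "v < n"
proof -
  have "\<exists>u v. e = {u, v} \<and> u \<noteq> v \<and> u < n \<and> v < n"
    using assms unfolding graph_on_def by (rule bspec)
  then obtain u v where "e = {u, v}" "u \<noteq> v" "u < n" "v < n" by (elim exE conjE)
  then show thesis
    using that[of u v] that[of v u] by (simp add: insert_commute neq_iff) metis
qed

text \<open>Each edge has exactly one orientation with \<open>u < v\<close>. This removes ordered
  pairs and lowest common ancestors from the rest of the argument.\<close>

lemma hc_cost_eq_sum_ecost:
  assumes "graph_on n E" "hc_tree n T"
  shows "hc_cost E T = (\<Sum>e\<in>E. ecost T e)"
proof -
  let ?P = "{(u, v). {u, v} \<in> E \<and> u < v}"
  have bij: "bij_betw (\<lambda>(u, v). {u, v}) ?P E"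
  proof (rule bij_betwI')
    show "(case a of (u, v) \<Rightarrow> {u, v}) = (case b of (u, v) \<Rightarrow> {u, v}) \<longleftrightarrow> a = b"
      if "a \<in> ?P" "b \<in> ?P" for a b
      using that by (auto simp: doubleton_eq_iff)
    show "(case a of (u, v) \<Rightarrow> {u, v}) \<in> E" if "a \<in> ?P" for a
      using that by auto
    show "\<exists>a\<in>?P. e = (case a of (u, v) \<Rightarrow> {u, v})" if eE: "e \<in> E" for e
    proof -
      obtain u v where "e = {u, v}" "u < v"
        using graph_onE[OF assms(1) eE] by metis
      then show ?thesis
        using eE by (intro bexI[of _ "(u, v)"]) auto
    qed
  qed
  have L: "leaves T = {0..<n}"
    using assms(2) unfolding hc_tree_def set_leaf_list by blast
  have "hc_cost E T = (\<Sum>a\<in>?P. ecost T (case a of (u, v) \<Rightarrow> {u, v}))"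
    unfolding hc_cost_def
  proof (rule sum.cong[OF refl], clarify)
    fix u v assume "{u, v} \<in> E" "u < v"
    then have "u \<in> leaves T" "v \<in> leaves T"
      using assms(1) unfolding L graph_on_def by (auto simp: doubleton_eq_iff)
    then show "card (leaves (lca_subtree T u v)) = ecost T {u, v}"
      by (rule card_lca_subtree)
  qed
  also have "\<dots> = (\<Sum>e\<in>E. ecost T e)"
    by (rule sum.reindex_bij_betw[OF bij])
  finally show ?thesis .
qed

section \<open>Cheap trees glued from pieces\<close>

text \<open>Only edges induced on \<open>S\<close> are paid for, so bounds for disjoint vertex sets
  can be combined. The numbering \<open>f\<close> permits an abstract vertex type.\<close>

definition tree_cost_le :: "('v \<Rightarrow> nat) \<Rightarrow> 'v set set \<Rightarrow> 'v set \<Rightarrow> nat \<Rightarrow> bool" where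
  "tree_cost_le f E S c \<longleftrightarrow> (\<exists>T. distinct (leaf_list T) \<and> leaves T = f ` S \<and>
     (\<Sum>e\<in>{e\<in>E. e \<subseteq> S}. ecost T (f ` e)) \<le> c)"

lemma tree_cost_le_mono: "tree_cost_le f E S c \<Longrightarrow> c \<le> c' \<Longrightarrow> tree_cost_le f E S c'"
  unfolding tree_cost_le_def using le_trans by blast

lemma tree_cost_le_flat:
  assumes "finite S" "inj_on f S"
  shows "tree_cost_le f E S (card {e\<in>E. e \<subseteq> S} * card S)"
proof -
  let ?T = "Node (map Leaf (sorted_list_of_set (f ` S)))"
  have leaves: "leaves ?T = f ` S" using assms by simp
  have "leaf_list ?T = sorted_list_of_set (f ` S)"
    by (simp add: comp_def)
  then have "distinct (leaf_list ?T)"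
    by (simp only: distinct_sorted_list_of_set)
  moreover have "(\<Sum>e\<in>{e\<in>E. e \<subseteq> S}. ecost ?T (f ` e)) \<le> of_nat (card {e\<in>E. e \<subseteq> S}) * card S"
  proof (rule sum_bounded_above)
    fix e assume "e \<in> {e\<in>E. e \<subseteq> S}"
    then have "f ` e \<subseteq> leaves ?T" unfolding leaves by blast
    from ecost_le[OF self_in_subtrees this] show "ecost ?T (f ` e) \<le> card S"
      unfolding leaves by (simp add: assms card_image)
  qed
  ultimately show ?thesis
    unfolding tree_cost_le_def using leaves by (intro exI[of _ ?T]) (simp only: of_nat_id simp_thms)
qed

text \<open>The two trees become children of a new root. Edges inside a part do not get more
  expensive; each of the at most \<open>r\<close> other edges pays at most the size of the
  union.\<close>

lemma tree_cost_le_Un: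
  assumes S1: "tree_cost_le f E S1 c1" and S2: "tree_cost_le f E S2 c2"
    and "finite E" "finite S1" "finite S2" "S1 \<inter> S2 = {}" "inj_on f (S1 \<union> S2)"
    and r: "card {e\<in>E. e \<subseteq> S1 \<union> S2 \<and> \<not> e \<subseteq> S1 \<and> \<not> e \<subseteq> S2} \<le> r"
  shows "tree_cost_le f E (S1 \<union> S2) (c1 + c2 + r * (card S1 + card S2))"
proof -
  obtain T1 where T1: "distinct (leaf_list T1)" "leaves T1 = f ` S1"
    "(\<Sum>e\<in>{e\<in>E. e \<subseteq> S1}. ecost T1 (f ` e)) \<le> c1"
    using S1 unfolding tree_cost_le_def by blast
  obtain T2 where T2: "distinct (leaf_list T2)" "leaves T2 = f ` S2"
    "(\<Sum>e\<in>{e\<in>E. e \<subseteq> S2}. ecost T2 (f ` e)) \<le> c2"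
    using S2 unfolding tree_cost_le_def by blast
  let ?T = "Node [T1, T2]"
  let ?X = "{e\<in>E. e \<subseteq> S1 \<union> S2 \<and> \<not> e \<subseteq> S1 \<and> \<not> e \<subseteq> S2}"
  let ?E1 = "{e\<in>E. e \<subseteq> S1}" and ?E2 = "{e\<in>E. e \<subseteq> S2}"
  have leaves: "leaves ?T = f ` (S1 \<union> S2)" using T1 T2 by auto
  have "f ` S1 \<inter> f ` S2 = {}"
    using assms by (metis image_empty inj_on_image_Int sup_ge1 sup_ge2)
  then have dist: "distinct (leaf_list ?T)"
    using T1 T2 by (simp add: set_leaf_list)
  have card: "card (leaves ?T) = card S1 + card S2"
    unfolding leaves using assms by (simp add: card_image card_Un_disjoint)
  have 1: "(\<Sum>e\<in>?E1. ecost ?T (f ` e)) \<le> c1"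
  proof (rule order_trans[OF sum_mono T1(3)])
    fix e assume "e \<in> ?E1"
    then show "ecost ?T (f ` e) \<le> ecost T1 (f ` e)"
      by (intro ecost_mono_subtree) (auto simp: T1 self_in_subtrees)
  qed
  have 2: "(\<Sum>e\<in>?E2. ecost ?T (f ` e)) \<le> c2"
  proof (rule order_trans[OF sum_mono T2(3)])
    fix e assume "e \<in> ?E2"
    then show "ecost ?T (f ` e) \<le> ecost T2 (f ` e)"
      by (intro ecost_mono_subtree) (auto simp: T2 self_in_subtrees)
  qed
  have "(\<Sum>e\<in>?X. ecost ?T (f ` e)) \<le> of_nat (card ?X) * (card S1 + card S2)"
  proof (rule sum_bounded_above)
    fix e assume "e \<in> ?X"
    then have "f ` e \<subseteq> leaves ?T" unfolding leaves by blast
    from ecost_le[OF self_in_subtrees this] show "ecost ?T (f ` e) \<le> card S1 + card S2"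
      unfolding card .
  qed
  also have "\<dots> \<le> r * (card S1 + card S2)"
    using r by (intro mult_right_mono) auto
  finally have 3: "(\<Sum>e\<in>?X. ecost ?T (f ` e)) \<le> r * (card S1 + card S2)" .
  have Un_le: "sum g (A \<union> B) \<le> sum g A + sum g B" if "finite A" "finite B" for g :: "'a set \<Rightarrow> nat" and A B
    using that by (simp add: sum_Un_nat)
  have split: "{e\<in>E. e \<subseteq> S1 \<union> S2} = ?E1 \<union> (?E2 \<union> ?X)" by blast
  have "(\<Sum>e\<in>{e\<in>E. e \<subseteq> S1 \<union> S2}. ecost ?T (f ` e)) \<le>
      (\<Sum>e\<in>?E1. ecost ?T (f ` e)) + ((\<Sum>e\<in>?E2. ecost ?T (f ` e)) + (\<Sum>e\<in>?X. ecost ?T (f ` e)))"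
    unfolding split using \<open>finite E\<close>
    by (intro order_trans[OF Un_le] add_left_mono Un_le) auto
  then show ?thesis
    unfolding tree_cost_le_def using 1 2 3 leaves dist
    by (intro exI[of _ ?T]) linarith
qed

lemma OPT_le_tree_cost:
  assumes bij: "bij_betw f V {0..<n}" and E: "\<And>e. e \<in> E \<Longrightarrow> e \<subseteq> V"
    and g: "graph_on n ((`) f ` E)" and c: "tree_cost_le f E V c"
  shows "OPT n ((`) f ` E) \<le> c"
proof -
  obtain T where T: "distinct (leaf_list T)" "leaves T = f ` V"
    "(\<Sum>e\<in>{e\<in>E. e \<subseteq> V}. ecost T (f ` e)) \<le> c"
    using c unfolding tree_cost_le_def by blast
  have tree: "hc_tree n T"
    unfolding hc_tree_def set_leaf_list using T bij by (auto simp: bij_betw_def)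
  have "inj_on ((`) f) E"
    using bij E by (intro inj_onI) (meson bij_betw_def inj_on_image_eq_iff)
  then have "(\<Sum>e\<in>(`) f ` E. ecost T e) = (\<Sum>e\<in>E. ecost T (f ` e))"
    by (simp add: sum.reindex)
  moreover have "{e\<in>E. e \<subseteq> V} = E" using E by blast
  ultimately have "hc_cost ((`) f ` E) T \<le> c"
    using hc_cost_eq_sum_ecost[OF g tree] T(3) by simp
  moreover have "OPT n ((`) f ` E) \<le> hc_cost ((`) f ` E) T"
    unfolding OPT_def by (rule Least_le) (use tree in blast)
  ultimately show ?thesis by linarith
qed

lemma card_pairs_le:
  assumes "finite A" "finite B" and X: "\<And>e. e \<in> X \<Longrightarrow> \<exists>u\<in>A. \<exists>v\<in>B. e = {u, v}"
  shows "card X \<le> card A * card B"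
proof -
  have "X \<subseteq> (\<lambda>(u, v). {u, v}) ` (A \<times> B)"
    using X by fastforce
  then have "card X \<le> card (A \<times> B)"
    by (meson assms card_image_le card_mono finite_SigmaI finite_imageI order_trans)
  then show ?thesis by (simp add: card_cartesian_product)
qed

text \<open>Recursive bisection of the sequence of layers. Edges stay within a layer or join
  consecutive ones, so each cut severs at most \<open>q * q\<close> edges, each paying at most
  \<open>len * q\<close>. One level of the recursion thus costs \<open>q ^ 3\<close> per layer;
  there are \<open>l\<close> levels, and the single layers at the bottom account for the
  \<open>Suc\<close>.\<close>

lemma tree_cost_le_path:
  fixes S :: "nat \<Rightarrow> 'v set"
  assumes "finite E" and E2: "\<And>e. e \<in> E \<Longrightarrow> card e = 2"
    and fin: "\<And>i. finite (S i)" and q: "\<And>i. card (S i) \<le> q"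
    and disj: "disjoint_family S"
    and adj: "\<And>e i j u v. e \<in> E \<Longrightarrow> u \<in> e \<inter> S i \<Longrightarrow> v \<in> e \<inter> S j \<Longrightarrow> i < j \<Longrightarrow> j = Suc i"
    and "inj_on f (\<Union>i\<in>{a..<a+len}. S i)" and "len \<le> 2 ^ l"
  shows "tree_cost_le f E (\<Union>i\<in>{a..<a+len}. S i) (len * (q ^ 3 * Suc l))"
  using assms(7,8)
proof (induction l arbitrary: a len)
  case 0
  show ?case
  proof (cases "len = 0")
    case True
    have "e \<noteq> {}" if "e \<in> E" for e using E2[OF that] by auto
    then show ?thesis using True tree_cost_le_flat[of "{}" f E] by simp
  next
    case False
    then have len: "len = 1" using 0 by simp
    have "card {e\<in>E. e \<subseteq> S a} \<le> card (S a) * card (S a)"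
    proof (rule card_pairs_le[OF fin fin])
      fix e assume "e \<in> {e\<in>E. e \<subseteq> S a}"
      then show "\<exists>u\<in>S a. \<exists>v\<in>S a. e = {u, v}"
        using E2[of e] unfolding card_2_iff by auto
    qed
    also have "\<dots> \<le> q * q" using q by (intro mult_mono) auto
    finally have "card {e\<in>E. e \<subseteq> S a} * card (S a) \<le> q * q * q"
      using q by (intro mult_mono) auto
    then show ?thesis
      using tree_cost_le_flat[OF fin, of f a E] 0 len
      by (auto simp: power3_eq_cube intro: tree_cost_le_mono)
  qed
next
  case (Suc l)
  define h where "h = len div 2"
  define S1 where "S1 = (\<Union>i\<in>{a..<a+h}. S i)"
  define S2 where "S2 = (\<Union>i\<in>{a+h..<a+h+(len-h)}. S i)"
  have U: "(\<Union>i\<in>{a..<a+len}. S i) = S1 \<union> S2"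
    unfolding S1_def S2_def h_def by (subst UN_Un[symmetric]) (rule arg_cong[of _ _ "\<lambda>A. \<Union> (S ` A)"], auto)
  have inj: "inj_on f (S1 \<union> S2)" using Suc.prems U by simp
  have h: "h \<le> 2 ^ l" "len - h \<le> 2 ^ l" "h \<le> len"
    using Suc.prems(2) unfolding h_def by auto
  have 1: "tree_cost_le f E S1 (h * (q ^ 3 * Suc l))"
    using Suc.IH[of a h] inj_on_subset[OF inj, of S1] h unfolding S1_def by blast
  have 2: "tree_cost_le f E S2 ((len - h) * (q ^ 3 * Suc l))"
    using Suc.IH[of "a + h" "len - h"] inj_on_subset[OF inj, of S2] h unfolding S2_def by blast
  have c: "card (\<Union>i\<in>{b..<b+k}. S i) \<le> k * q" for b k
  proof -
    have "card (\<Union>i\<in>{b..<b+k}. S i) \<le> (\<Sum>i\<in>{b..<b+k}. card (S i))"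
      by (rule card_UN_le) simp
    also have "\<dots> \<le> (\<Sum>i\<in>{b..<b+k}. q)"
      by (rule sum_mono[OF q])
    finally show ?thesis by simp
  qed
  have X: "card {e\<in>E. e \<subseteq> S1 \<union> S2 \<and> \<not> e \<subseteq> S1 \<and> \<not> e \<subseteq> S2} \<le> q * q"
  proof -
    \<comment> \<open>A severed edge joins the last layer of \<open>S1\<close> to the first layer of
      \<open>S2\<close>. For \<open>h = 0\<close> the index \<open>a + h - 1\<close> is harmless, as
      \<open>S1\<close> is then empty.\<close>
    have "card {e\<in>E. e \<subseteq> S1 \<union> S2 \<and> \<not> e \<subseteq> S1 \<and> \<not> e \<subseteq> S2} \<le> card (S (a + h - 1)) * card (S (a + h))"
    proof (rule card_pairs_le[OF fin fin])
      fix e assume e: "e \<in> {e\<in>E. e \<subseteq> S1 \<union> S2 \<and> \<not> e \<subseteq> S1 \<and> \<not> e \<subseteq> S2}"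
      then obtain u v where "u \<in> e" "u \<notin> S2" "v \<in> e" "v \<notin> S1" by blast
      with e have uv: "u \<in> e" "v \<in> e" "u \<in> S1" "v \<in> S2" "u \<noteq> v" by blast+
      obtain u' v' where "e = {u', v'}" using e E2 unfolding card_2_iff by blast
      then have e2: "e = {u, v}" using uv by auto
      obtain i j where "u \<in> S i" "i < a + h" "v \<in> S j" "a + h \<le> j"
        using uv(3,4) unfolding S1_def S2_def by auto
      moreover from this have "j = Suc i" using adj[of e u i v j] e uv(1,2) by simp
      ultimately have "u \<in> S (a + h - 1)" "v \<in> S (a + h)"
        by (metis Suc_leI diff_Suc_1 le_antisym)+
      then show "\<exists>u\<in>S (a + h - 1). \<exists>v\<in>S (a + h). e = {u, v}" using e2 by blast
    qed
    also have "\<dots> \<le> q * q" using q by (intro mult_mono) auto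
    finally show ?thesis .
  qed
  have "S1 \<inter> S2 = {}"
  proof (rule ccontr)
    assume "S1 \<inter> S2 \<noteq> {}"
    then obtain z i j where "z \<in> S i" "i < a + h" "z \<in> S j" "a + h \<le> j"
      unfolding S1_def S2_def by auto
    then show False
      using disjoint_family_onD[OF disj, of i j] by auto
  qed
  moreover have "finite S1" "finite S2" unfolding S1_def S2_def by (simp_all add: fin)
  ultimately have "tree_cost_le f E (S1 \<union> S2) (h * (q ^ 3 * Suc l) + (len - h) * (q ^ 3 * Suc l)
      + q * q * (card S1 + card S2))"
    using tree_cost_le_Un[OF 1 2 \<open>finite E\<close> _ _ _ inj X] by blast
  moreover have "h * (q ^ 3 * Suc l) + (len - h) * (q ^ 3 * Suc l) = len * (q ^ 3 * Suc l)"
    by (subst add_mult_distrib[symmetric]) (simp add: h)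
  moreover have "q * q * (card S1 + card S2) \<le> q * q * (h * q + (len - h) * q)"
    using c[of a h] c[of "a + h" "len - h"] unfolding S1_def S2_def
    by (intro mult_left_mono add_mono) auto
  moreover have "h * q + (len - h) * q = len * q"
    by (subst add_mult_distrib[symmetric]) (simp add: h)
  ultimately show ?case
    unfolding U by (elim tree_cost_le_mono) (simp add: power3_eq_cube algebra_simps)
qed

text \<open>Let \<open>D\<close> be the leaf set of a largest subtree that contains \<open>c\<close>
  but fewer than half of the \<open>m * K\<close> vertices of the sets \<open>W j\<close>. At least
  half of the \<open>W j\<close> are not inside \<open>D\<close>, and by \<open>cut\<close> each of
  them supplies its own edge leaving \<open>D\<close>. By laminarity the subtree pricing such an
  edge properly contains \<open>D\<close>, so by maximality it has at least \<open>m * K / 2\<close>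
  leaves. Hence at least \<open>m / 2\<close> edges each cost at least
  \<open>m * K / 2\<close>.\<close>

lemma hc_cost_star_lower:
  fixes W :: "nat \<Rightarrow> nat set" and F :: "nat \<Rightarrow> nat set set"
  assumes g: "graph_on n E" and tree: "hc_tree n T" and "c < n"
    and W: "\<And>j. j < m \<Longrightarrow> W j \<subseteq> {0..<n}" "\<And>j. j < m \<Longrightarrow> card (W j) = K"
      "disjoint_family_on W {..<m}" "\<And>j. j < m \<Longrightarrow> c \<notin> W j"
    and F: "\<And>j. j < m \<Longrightarrow> F j \<subseteq> E" "disjoint_family_on F {..<m}"
    and pos: "0 < m * K"
    and cut: "\<And>j D. j < m \<Longrightarrow> c \<in> D \<Longrightarrow> \<not> W j \<subseteq> D \<Longrightarrow> \<exists>e\<in>F j. e \<inter> D \<noteq> {} \<and> \<not> e \<subseteq> D"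
  shows "m * (m * K) \<le> 4 * hc_cost E T"
proof -
  define WW where "WW = (\<Union>j<m. W j)"
  have finW: "finite (W j)" if "j < m" for j
    using W(1)[OF that] finite_subset by blast
  have cardWW: "card WW = m * K"
    unfolding WW_def using W finW by (subst card_UN_disjoint') auto
  have L: "leaves T = {0..<n}" and dist: "distinct (leaf_list T)"
    using tree unfolding hc_tree_def set_leaf_list by auto
  define P where "P = (\<lambda>S. S \<in> subtrees T \<and> c \<in> leaves S \<and> 2 * card (leaves S \<inter> WW) < m * K)"
  \<comment> \<open>The leaf \<open>c\<close> alone meets no \<open>W j\<close>, so candidates
    exist; their sizes are bounded by \<open>n\<close>.\<close>
  have "P (Leaf c)"
    unfolding P_def using Leaf_in_subtrees[of c T] L \<open>c < n\<close> W(4) pos by (auto simp: WW_def)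
  moreover have "\<forall>S. P S \<longrightarrow> card (leaves S) < Suc n"
  proof (intro allI impI)
    fix S assume "P S"
    then have "leaves S \<subseteq> {0..<n}" using leaves_subtree_subset L unfolding P_def by blast
    from card_mono[OF _ this] show "card (leaves S) < Suc n" by simp
  qed
  ultimately obtain S where S: "P S" and S_max: "\<And>S'. P S' \<Longrightarrow> card (leaves S') \<le> card (leaves S)"
    using ex_has_greatest_nat[of P "Leaf c" "\<lambda>S. card (leaves S)" "Suc n"] by blast
  define D where "D = leaves S"
  define J where "J = {j. j < m \<and> \<not> W j \<subseteq> D}"
  have big: "m * K \<le> 2 * card (leaves S')" if "S' \<in> subtrees T" "leaves S' \<inter> D \<noteq> {}" "\<not> leaves S' \<subseteq> D" for S'
  proof -
    have "D \<subset> leaves S'"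
      using subtrees_laminar[OF dist that(1), of S] that S unfolding D_def P_def by blast
    then have "card D < card (leaves S')"
      by (intro psubset_card_mono finite_leaves)
    then have "\<not> P S'" using S_max unfolding D_def by fastforce
    then have "m * K \<le> 2 * card (leaves S' \<inter> WW)"
      using that(1) S \<open>D \<subset> leaves S'\<close> unfolding P_def D_def by auto
    also have "\<dots> \<le> 2 * card (leaves S')"
      by (simp add: card_mono finite_leaves)
    finally show ?thesis .
  qed
  have "\<exists>e. e \<in> F j \<and> e \<inter> D \<noteq> {} \<and> \<not> e \<subseteq> D" if "j \<in> J" for j
    using cut[of j D] that S unfolding J_def D_def P_def by auto
  then obtain e where e: "\<And>j. j \<in> J \<Longrightarrow> e j \<in> F j \<and> e j \<inter> D \<noteq> {} \<and> \<not> e j \<subseteq> D"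
    by metis
  have inj: "inj_on e J"
  proof (rule inj_onI, rule ccontr)
    fix i j assume ij: "i \<in> J" "j \<in> J" "e i = e j" "i \<noteq> j"
    then show False
      using e[of i] e[of j] F(2) unfolding J_def disjoint_family_on_def by auto
  qed
  have eE: "e j \<in> E" if "j \<in> J" for j
    using that e[OF that] F(1)[of j] unfolding J_def by blast
  have cost_e: "m * K \<le> 2 * ecost T (e j)" if j: "j \<in> J" for j
  proof -
    have "e j \<subseteq> leaves T"
      using eE[OF j] g unfolding L graph_on_def by auto
    then obtain S' where "S' \<in> subtrees T" "e j \<subseteq> leaves S'" "ecost T (e j) = card (leaves S')"
      by (rule ecost_attained)
    then show ?thesis using big[of S'] e[OF j] by auto
  qed
  have cardJ: "m \<le> 2 * card J"
  proof -
    have "{..<m} = J \<union> ({..<m} - J)" "J \<inter> ({..<m} - J) = {}" unfolding J_def by auto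
    then have c1: "m = card J + card ({..<m} - J)"
      by (metis card_Un_disjoint card_lessThan finite_Un finite_lessThan)
    have "(m - card J) * K = card (\<Union>j\<in>{..<m} - J. W j)"
      using W finW c1
      by (subst card_UN_disjoint') (auto simp: disjoint_family_on_def)
    also have "\<dots> \<le> card (leaves S \<inter> WW)"
      by (intro card_mono) (auto simp: J_def WW_def D_def finite_leaves)
    finally have "2 * ((m - card J) * K) < m * K"
      using S unfolding P_def by linarith
    then have "(2 * (m - card J)) * K < m * K" by simp
    then show ?thesis by (simp only: mult_less_cancel2) linarith
  qed
  have "m * (m * K) \<le> 2 * card J * (m * K)"
    using cardJ by (rule mult_right_mono) simp
  also have "\<dots> = 2 * (\<Sum>j\<in>J. m * K)" by simp
  also have "\<dots> \<le> 2 * (\<Sum>j\<in>J. 2 * ecost T (e j))"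
    by (intro mult_left_mono sum_mono cost_e) auto
  also have "\<dots> = 4 * (\<Sum>x\<in>e ` J. ecost T x)"
    by (simp add: sum.reindex[OF inj] sum_distrib_left)
  also have "\<dots> \<le> 4 * (\<Sum>x\<in>E. ecost T x)"
    using eE graph_on_finite[OF g] by (intro mult_left_mono sum_mono2) auto
  finally show ?thesis
    using hc_cost_eq_sum_ecost[OF g tree] by simp
qed

lemma OPT_attained:
  obtains T where "hc_tree n T" "hc_cost E T = OPT n E"
proof -
  let ?T = "Node (map Leaf [0..<n])"
  have "leaf_list ?T = [0..<n]" by (simp add: comp_def)
  then have "hc_tree n ?T" unfolding hc_tree_def by (simp only:) simp
  then have "\<exists>c T. hc_tree n T \<and> hc_cost E T = c" by blast
  from LeastI_ex[OF this] show ?thesis using that unfolding OPT_def by blast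
qed

text \<open>No edge joins two different sets \<open>A j\<close>, so every gluing severs nothing and
  the costs simply add up.\<close>

lemma tree_cost_le_UN:
  fixes A :: "nat \<Rightarrow> 'v set"
  assumes "finite E" and "\<And>j. j < m \<Longrightarrow> finite (A j)" and "disjoint_family_on A {..<m}"
    and "inj_on f (\<Union>j<m. A j)" and "\<And>j. j < m \<Longrightarrow> tree_cost_le f E (A j) c"
    and "{} \<notin> E"
    and "\<And>e u v j k. e \<in> E \<Longrightarrow> u \<in> e \<inter> A j \<Longrightarrow> v \<in> e \<inter> A k \<Longrightarrow> j < m \<Longrightarrow> k < m \<Longrightarrow> j = k"
  shows "tree_cost_le f E (\<Union>j<m. A j) (m * c)"
  using assms(2-7)
proof (induction m)
  case 0
  have none: "{e \<in> E. e \<subseteq> {}} = {}" using \<open>{} \<notin> E\<close> by auto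
  show ?case using tree_cost_le_flat[of "{}" f E] unfolding none by simp
next
  case (Suc m)
  let ?U = "\<Union>j<m. A j"
  have U: "(\<Union>j<Suc m. A j) = ?U \<union> A m" by (auto simp: less_Suc_eq)
  have 1: "tree_cost_le f E ?U (m * c)"
  proof (rule Suc.IH)
    show "disjoint_family_on A {..<m}"
      using Suc.prems(2) by (rule disjoint_family_on_mono[rotated]) auto
    show "inj_on f ?U"
      using Suc.prems(3) by (rule inj_on_subset) (unfold U, blast)
  qed (use Suc.prems in auto)
  have 2: "tree_cost_le f E (A m) c" using Suc.prems by simp
  have none: "{e\<in>E. e \<subseteq> ?U \<union> A m \<and> \<not> e \<subseteq> ?U \<and> \<not> e \<subseteq> A m} = {}"
  proof (rule ccontr)
    assume "\<not> ?thesis"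
    then obtain e where e: "e \<in> E" "e \<subseteq> ?U \<union> A m" "\<not> e \<subseteq> ?U" "\<not> e \<subseteq> A m" by blast
    then obtain u v where "u \<in> e" "u \<notin> ?U" "v \<in> e" "v \<notin> A m" by blast
    with e obtain j where "u \<in> e \<inter> A m" "v \<in> e \<inter> A j" "j < m" by blast
    then show False using Suc.prems(6)[OF e(1), of u m v j] by simp
  qed
  have "?U \<inter> A m = {}"
  proof (rule ccontr)
    assume "?U \<inter> A m \<noteq> {}"
    then obtain j where "j < m" "A j \<inter> A m \<noteq> {}" by blast
    then show False using disjoint_family_onD[OF Suc.prems(2), of j m] by simp
  qed
  moreover have "finite ?U" "finite (A m)" using Suc.prems(1) by auto
  moreover have "inj_on f (?U \<union> A m)" using Suc.prems(3) unfolding U .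
  ultimately have "tree_cost_le f E (?U \<union> A m) (m * c + c + 0 * (card ?U + card (A m)))"
    using none by (intro tree_cost_le_Un[OF 1 2 \<open>finite E\<close>]) simp_all
  then show ?case unfolding U by (simp add: add.commute)
qed

section \<open>The hard graphs\<close>

text \<open>\<open>Wire j i t p\<close> lies at layer \<open>i\<close> on track \<open>p\<close> of wire \<open>j\<close>. The vertices with \<open>t = 0\<close> separate
  consecutive layers; if \<open>i \<in> x\<close> the first player routes the tracks of layer \<open>i\<close> through the vertices
  \<open>t = 1, 2\<close>, between which the second player has placed either parallel or crossing edges.\<close>

datatype vertex = Hub | Block nat nat | Wire nat nat nat bool | Spare nat

text \<open>The hub meets the wire at layer \<open>N\<close> and the block hangs at layer
  \<open>0\<close>, both on track \<open>False\<close>; the ends of the other track stay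
  free.\<close>

inductive alice :: "nat \<Rightarrow> nat \<Rightarrow> nat set \<Rightarrow> nat \<Rightarrow> vertex \<Rightarrow> vertex \<Rightarrow> bool" for K N x j where
  hub: "alice K N x j Hub (Wire j N 0 False)"
| attach: "alice K N x j (Wire j 0 0 False) (Block j 0)"
| block: "Suc i < K \<Longrightarrow> alice K N x j (Block j i) (Block j (Suc i))"
| skip: "i < N \<Longrightarrow> i \<notin> x \<Longrightarrow> alice K N x j (Wire j i 0 p) (Wire j (Suc i) 0 p)"
| enter: "i < N \<Longrightarrow> i \<in> x \<Longrightarrow> alice K N x j (Wire j i 0 p) (Wire j i 1 p)"
| leave: "i < N \<Longrightarrow> i \<in> x \<Longrightarrow> alice K N x j (Wire j i 2 p) (Wire j (Suc i) 0 p)"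

text \<open>These edges are present in every layer, so that they do not depend on \<open>x\<close>;
  in a layer outside \<open>x\<close> they are detached from the tracks.\<close>

inductive bob :: "nat \<Rightarrow> nat set \<Rightarrow> nat \<Rightarrow> vertex \<Rightarrow> vertex \<Rightarrow> bool" for N y j where
  cross: "i < N \<Longrightarrow> bob N y j (Wire j i 1 p) (Wire j i 2 (p \<noteq> (i \<in> y)))"

definition alice_edges :: "nat \<Rightarrow> nat \<Rightarrow> nat set \<Rightarrow> nat \<Rightarrow> vertex set set" where
  "alice_edges K N x j = {{u, v} | u v. alice K N x j u v}"

definition bob_edges :: "nat \<Rightarrow> nat set \<Rightarrow> nat \<Rightarrow> vertex set set" where
  "bob_edges N y j = {{u, v} | u v. bob N y j u v}"

definition blocks :: "nat \<Rightarrow> nat \<Rightarrow> vertex set" where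
  "blocks K j = Block j ` {..<K}"

definition wires :: "nat \<Rightarrow> nat \<Rightarrow> vertex set" where
  "wires N j = (\<lambda>(i, t, p). Wire j i t p) ` ({..N} \<times> {..<3} \<times> UNIV)"

lemma mem_wires [simp]:
  "Wire k i t p \<in> wires N j \<longleftrightarrow> k = j \<and> i \<le> N \<and> t < 3"
  "Hub \<notin> wires N j" "Block k i \<notin> wires N j" "Spare i \<notin> wires N j"
  unfolding wires_def by (auto simp: image_iff)

lemma mem_blocks [simp]:
  "Block k i \<in> blocks K j \<longleftrightarrow> k = j \<and> i < K"
  "Hub \<notin> blocks K j" "Wire k i t p \<notin> blocks K j" "Spare i \<notin> blocks K j"
  unfolding blocks_def by (auto simp: image_iff)

lemma wiresE:
  assumes "v \<in> wires N j"
  obtains i t p where "v = Wire j i t p" "i \<le> N" "t < 3"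
  using assms unfolding wires_def by auto

lemma blocksE:
  assumes "v \<in> blocks K j"
  obtains i where "v = Block j i" "i < K"
  using assms unfolding blocks_def by auto

lemma wires_not_blocks: "v \<in> wires N i \<Longrightarrow> v \<notin> blocks K j"
  by (cases v) auto

text \<open>The parity of the exchanges below layer \<open>i\<close>: the path that starts on track
  \<open>False\<close> at layer \<open>0\<close> reaches layer \<open>i\<close> on track
  \<open>swaps x y i\<close>.\<close>

definition swaps :: "nat set \<Rightarrow> nat set \<Rightarrow> nat \<Rightarrow> bool" where
  "swaps x y i \<longleftrightarrow> odd (card (x \<inter> y \<inter> {..<i}))"

lemma swaps_0 [simp]: "\<not> swaps x y 0"
  unfolding swaps_def by simp

lemma swaps_Suc: "swaps x y (Suc i) \<longleftrightarrow> (swaps x y i \<noteq> (i \<in> x \<and> i \<in> y))"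
proof (cases "i \<in> x \<inter> y")
  case True
  then have "x \<inter> y \<inter> {..<Suc i} = insert i (x \<inter> y \<inter> {..<i})" by auto
  then show ?thesis using True unfolding swaps_def by simp
next
  case False
  then have "x \<inter> y \<inter> {..<Suc i} = x \<inter> y \<inter> {..<i}" using less_Suc_eq by auto
  then show ?thesis using False unfolding swaps_def by simp
qed

lemma swaps_full: "x \<subseteq> {..<N} \<Longrightarrow> swaps x y N \<longleftrightarrow> odd (card (x \<inter> y))"
  unfolding swaps_def by (metis Int_absorb2 le_infI1)

text \<open>The side is constant on components of a wire, dead ends included; \<open>False\<close> marks the component of
  the end attached to the block.\<close>

fun side :: "nat set \<Rightarrow> nat set \<Rightarrow> vertex \<Rightarrow> bool" where
  "side x y (Wire j i t p) = (if t = 2 then (p \<noteq> (i \<in> y)) \<noteq> swaps x y i else p \<noteq> swaps x y i)"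
| "side x y _ = False"

text \<open>The value \<open>0\<close> at the hub is a default; facts about \<open>idx\<close>
  exclude the hub.\<close>

fun idx :: "vertex \<Rightarrow> nat" where
  "idx (Wire j i t p) = j" | "idx (Block j i) = j" | "idx _ = 0"

fun layer :: "vertex \<Rightarrow> nat" where
  "layer (Wire j i t p) = i" | "layer (Block j i) = i" | "layer _ = 0"

text \<open>Hub edges are excluded: \<open>Hub\<close> has the default side \<open>False\<close>,
  whereas \<open>Wire j N 0 False\<close> has side \<open>swaps x y N\<close>. In the odd case this
  difference separates the hub from the blocks.\<close>

lemma alice_side: "alice K N x j u v \<Longrightarrow> u \<noteq> Hub \<Longrightarrow> side x y u = side x y v"
  by (cases rule: alice.cases) (auto simp: swaps_Suc)

lemma bob_side: "bob N y j u v \<Longrightarrow> side x y u = side x y v"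
  by (cases rule: bob.cases) auto

text \<open>Only edges of the second player join \<open>t = 1\<close> to \<open>t = 2\<close>.
  Disjointness matters because a stream must not repeat an edge.\<close>

lemma alice_bob_disjoint:
  assumes "alice K N x j u v" "bob N y k u' v'"
  shows "{u, v} \<noteq> {u', v'}"
  using assms(2)
proof cases
  case (cross i p)
  from assms(1) show ?thesis
    by (cases rule: alice.cases) (simp_all add: cross doubleton_eq_iff)
qed

section \<open>The optimum of the hard graphs in terms of the parity\<close>

locale gadget =
  fixes m K N :: nat and x y :: "nat set"
  assumes K: "K > 0"
begin

definition F :: "nat \<Rightarrow> vertex set set" where
  "F j = alice_edges K N x j \<union> bob_edges N y j"

definition E :: "vertex set set" where
  "E = (\<Union>j<m. F j)"

definition core :: "vertex set" where
  "core = insert Hub (\<Union>j<m. blocks K j \<union> wires N j)"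

text \<open>Merges the edges of both players into four shapes. Edges inside a wire preserve
  \<open>side\<close> and advance by at most one layer, which is what the upper bound uses.\<close>

lemma F_cases:
  assumes "e \<in> F j"
  obtains (hub) "e = {Hub, Wire j N 0 False}"
  | (attach) "e = {Wire j 0 0 False, Block j 0}"
  | (block) i where "Suc i < K" "e = {Block j i, Block j (Suc i)}"
  | (wire) u v where "e = {u, v}" "u \<noteq> v" "u \<in> wires N j" "v \<in> wires N j" "side x y u = side x y v"
      "layer v = layer u \<or> layer v = Suc (layer u)"
proof -
  from assms obtain u v where e: "e = {u, v}" and "alice K N x j u v \<or> bob N y j u v"
    unfolding F_def alice_edges_def bob_edges_def by blast
  then show ?thesis
  proof (elim disjE)
    assume a: "alice K N x j u v"
    show ?thesis
    proof (cases "\<exists>i. v = Block j i")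
      case True
      with a show ?thesis
        by (cases rule: alice.cases) (use True e attach block in auto)
    next
      case F: False
      show ?thesis
      proof (cases "u = Hub")
        case True
        from a show ?thesis by (cases rule: alice.cases) (use True e hub in auto)
      next
        case False
        have "u \<in> wires N j \<and> v \<in> wires N j \<and> u \<noteq> v \<and> (layer v = layer u \<or> layer v = Suc (layer u))"
          using a by (cases rule: alice.cases) (use F False in auto)
        then show ?thesis
          using e alice_side[OF a False, of y] wire by blast
      qed
    qed
  next
    assume b: "bob N y j u v"
    then have "u \<in> wires N j \<and> v \<in> wires N j \<and> u \<noteq> v \<and> layer v = layer u"
      by (cases rule: bob.cases) auto
    then show ?thesis using e bob_side[OF b, of x] wire by blast
  qed
qed

lemma card_F: "e \<in> F j \<Longrightarrow> card e = 2"
  by (erule F_cases) (auto simp: card_insert_if)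

lemma F_core: "e \<in> F j \<Longrightarrow> j < m \<Longrightarrow> e \<subseteq> core"
  using K by (erule_tac F_cases) (auto simp: core_def blocks_def wires_def image_iff)

lemma finite_core: "finite core"
  unfolding core_def blocks_def wires_def by auto

lemma card_wires: "card (wires N j) = 6 * Suc N"
  unfolding wires_def
  by (subst card_image) (auto simp: inj_on_def card_cartesian_product card_UNIV_bool)

lemma card_blocks: "card (blocks K j) = K"
  unfolding blocks_def by (subst card_image) (auto simp: inj_on_def)

lemma card_core: "card core \<le> 1 + m * K + 6 * m * Suc N"
proof -
  have "card core \<le> 1 + card (\<Union>j<m. blocks K j \<union> wires N j)"
    unfolding core_def by (simp add: card_insert_le_m1 card_insert_if)
  also have "card (\<Union>j<m. blocks K j \<union> wires N j) \<le> (\<Sum>j<m. card (blocks K j \<union> wires N j))"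
    by (rule card_UN_le) simp
  also have "\<dots> \<le> (\<Sum>j<m. K + 6 * Suc N)"
    by (intro sum_mono order_trans[OF card_Un_le]) (simp add: card_blocks card_wires)
  finally show ?thesis by (simp add: algebra_simps)
qed

lemma E_core: "e \<in> E \<Longrightarrow> e \<subseteq> core"
  unfolding E_def using F_core by blast

lemma finite_E: "finite E"
  by (rule finite_subset[of _ "Pow core"]) (use E_core finite_core in auto)

lemma card_E: "e \<in> E \<Longrightarrow> card e = 2"
  unfolding E_def using card_F by blast

lemma F_idx: "e \<in> F j \<Longrightarrow> e - {Hub} \<noteq> {} \<and> (\<forall>v\<in>e - {Hub}. idx v = j)"
  by (erule F_cases) (auto simp: wires_def)

lemma F_disjoint: "disjoint_family_on F {..<m}"
  using F_idx unfolding disjoint_family_on_def by (metis disjoint_iff ex_in_conv)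

lemma E_idx: "e \<in> E \<Longrightarrow> u \<in> e \<Longrightarrow> v \<in> e \<Longrightarrow> u \<noteq> Hub \<Longrightarrow> v \<noteq> Hub \<Longrightarrow> idx u = idx v"
  unfolding E_def using F_idx by (metis DiffI UN_E singletonD)

text \<open>Side \<open>False\<close> is grouped with the block of wire \<open>j\<close>, and in the
  odd case side \<open>True\<close> with the hub.\<close>

definition wire_side :: "bool \<Rightarrow> nat \<Rightarrow> vertex set" where
  "wire_side b j = {v \<in> wires N j. side x y v = b}"

lemma E_side:
  assumes "e \<in> E" "u \<in> e" "v \<in> e" "u \<noteq> Hub" "v \<noteq> Hub"
  shows "side x y u = side x y v"
proof -
  obtain j where "e \<in> F j" using assms(1) unfolding E_def by blast
  then show ?thesis by (rule F_cases) (use assms(2-) in auto)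
qed

lemma E_Hub:
  assumes "e \<in> E" "Hub \<in> e"
  shows "\<exists>j<m. e = {Hub, Wire j N 0 False}"
proof -
  obtain j where j: "e \<in> F j" "j < m" using assms unfolding E_def by blast
  show ?thesis by (rule F_cases[OF j(1)]) (use assms(2) j(2) in auto)
qed

lemma E_layer:
  assumes "e \<in> E" "u \<in> e" "v \<in> e" "layer u < layer v" "u \<in> wires N j \<and> v \<in> wires N j \<or> u \<in> blocks K j \<and> v \<in> blocks K j"
  shows "layer v = Suc (layer u)"
proof -
  obtain k where "e \<in> F k" using assms(1) unfolding E_def by blast
  then show ?thesis by (rule F_cases) (use assms(2-) in auto)
qed

lemma E_attach:
  assumes "e \<in> E" "u \<in> e" "v \<in> e" "u \<in> wires N j" "v \<in> blocks K j"
  shows "e = {Wire j 0 0 False, Block j 0}"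
proof -
  obtain k where "e \<in> F k" using assms(1) unfolding E_def by blast
  then show ?thesis
    by (rule F_cases) (use assms(2-) wires_not_blocks[of u N j K j] wires_not_blocks[of v N k K j] in auto)
qed

text \<open>In the odd case no edge runs between the blocks with their \<open>False\<close> sides
  and the hub with the \<open>True\<close> sides. Blocks and sides are priced by bisection; the
  \<open>m\<close> hub edges pay only for the hub part, of at most \<open>1 + 6 * m * Suc N\<close>
  vertices. Since \<open>m * Suc N \<le> K\<close>, everything is of the order of the cost
  \<open>m * K * Suc L\<close> of the blocks.\<close>

lemma tree_cost_upper:
  assumes odd: "swaps x y N" and V: "core \<subseteq> V" "V \<subseteq> core \<union> range Spare" "finite V"
    and inj: "inj_on f V" and L: "K \<le> 2 ^ L" "m * Suc N \<le> K" and m: "m > 0"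
  shows "tree_cost_le f E V (450 * (m * K * Suc L))"
proof -
  have empty: "{} \<notin> E" using card_E[of "{}"] by auto
  have inj': "inj_on f A" if "A \<subseteq> core" for A using inj V(1) that inj_on_subset by blast
  have blocks_core: "blocks K j \<subseteq> core" and wires_core: "wires N j \<subseteq> core" if "j < m" for j
    using that unfolding core_def by auto
  have side_core: "wire_side b j \<subseteq> core" if "j < m" for b j
    using wires_core[OF that] unfolding wire_side_def by auto
  have fin_wires: "finite (wires N j)" for j
    unfolding wires_def by auto
  have fin_side: "finite (wire_side b j)" for b j
    unfolding wire_side_def using fin_wires by auto
  have fin_blocks: "finite (blocks K j)" for j
    unfolding blocks_def by auto
  have SN: "Suc N \<le> 2 ^ L"
  proof -
    have "1 * Suc N \<le> m * Suc N" using m by (intro mult_right_mono) auto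
    then have "Suc N \<le> m * Suc N" by (simp only: mult_1)
    then show ?thesis using L by (meson order_trans)
  qed
  have blocks: "tree_cost_le f E (blocks K j) (K * Suc L)" if j: "j < m" for j
  proof -
    let ?S = "\<lambda>i. {v \<in> blocks K j. layer v = i}"
    have U: "blocks K j = (\<Union>i\<in>{0..<0 + K}. ?S i)"
      unfolding blocks_def by auto
    have "tree_cost_le f E (\<Union>i\<in>{0..<0 + K}. ?S i) (K * (1 ^ 3 * Suc L))"
    proof (rule tree_cost_le_path[OF finite_E card_E _ _ _ _ _ L(1)])
      show "card (?S i) \<le> 1" for i
        by (rule order_trans[OF card_mono[of "{Block j i}"]]) (auto simp: blocks_def)
      show "disjoint_family ?S" unfolding disjoint_family_on_def by auto
      show "b = Suc a" if "e \<in> E" "u \<in> e \<inter> ?S a" "v \<in> e \<inter> ?S b" "a < b" for e a b u v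
        using E_layer[of e u v j] that by auto
      show "inj_on f (\<Union>i\<in>{0..<0 + K}. ?S i)"
        unfolding U[symmetric] by (rule inj'[OF blocks_core[OF j]])
    qed (use fin_blocks in auto)
    then show ?thesis unfolding U[symmetric] by simp
  qed
  have wire: "tree_cost_le f E (wire_side b j) (Suc N * (6 ^ 3 * Suc L))" if j: "j < m" for j b
  proof -
    let ?S = "\<lambda>i. {v \<in> wire_side b j. layer v = i}"
    have U: "wire_side b j = (\<Union>i\<in>{0..<0 + Suc N}. ?S i)"
      unfolding wire_side_def by (auto elim!: wiresE)
    have "tree_cost_le f E (\<Union>i\<in>{0..<0 + Suc N}. ?S i) (Suc N * (6 ^ 3 * Suc L))"
    proof (rule tree_cost_le_path[OF finite_E card_E _ _ _ _ _ SN])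
      \<comment> \<open>Three values of \<open>t\<close> on two tracks, counted without regard to
        the side.\<close>
      show "card (?S i) \<le> 6" for i
      proof -
        have "?S i \<subseteq> (\<lambda>(t, p). Wire j i t p) ` ({..<3} \<times> UNIV)"
          unfolding wire_side_def by (auto elim!: wiresE simp: image_iff)
        then have "card (?S i) \<le> card ((\<lambda>(t, p). Wire j i t p) ` ({..<3::nat} \<times> UNIV))"
          by (intro card_mono) auto
        also have "\<dots> \<le> card ({..<3::nat} \<times> (UNIV :: bool set))" by (rule card_image_le) simp
        finally show ?thesis by (simp add: card_cartesian_product card_UNIV_bool)
      qed
      show "disjoint_family ?S" unfolding disjoint_family_on_def by auto
      show "c = Suc a" if "e \<in> E" "u \<in> e \<inter> ?S a" "v \<in> e \<inter> ?S c" "a < c" for e a c u v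
        using E_layer[of e u v j] that unfolding wire_side_def by auto
      show "inj_on f (\<Union>i\<in>{0..<0 + Suc N}. ?S i)"
        unfolding U[symmetric] by (rule inj'[OF side_core[OF j]])
    qed (use fin_side in auto)
    then show ?thesis unfolding U[symmetric] .
  qed
  \<comment> \<open>The last summand pays for the single edge attaching the block to its
    wire.\<close>
  define c1 where "c1 = K * Suc L + Suc N * (6 ^ 3 * Suc L) + 1 * (K + 6 * Suc N)"
  define A where "A = (\<lambda>j. blocks K j \<union> wire_side False j)"
  have A: "tree_cost_le f E (A j) c1" if j: "j < m" for j
  proof -
    have "tree_cost_le f E (A j) (K * Suc L + Suc N * (6 ^ 3 * Suc L) + 1 * (card (blocks K j) + card (wire_side False j)))"
      unfolding A_def
    proof (rule tree_cost_le_Un[OF blocks[OF j] wire[OF j] finite_E fin_blocks fin_side])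
      show "blocks K j \<inter> wire_side False j = {}"
        unfolding wire_side_def using wires_not_blocks by blast
      show "inj_on f (blocks K j \<union> wire_side False j)"
        using blocks_core side_core j by (intro inj') auto
      have "{e \<in> E. e \<subseteq> blocks K j \<union> wire_side False j \<and> \<not> e \<subseteq> blocks K j \<and> \<not> e \<subseteq> wire_side False j}
          \<subseteq> {{Wire j 0 0 False, Block j 0}}" (is "?X \<subseteq> _")
      proof
        fix e assume e: "e \<in> ?X"
        then obtain u v where "u \<in> e" "u \<notin> blocks K j" "v \<in> e" "v \<notin> wire_side False j" by blast
        then have "u \<in> wires N j" "v \<in> blocks K j" using e unfolding wire_side_def by blast+
        then show "e \<in> {{Wire j 0 0 False, Block j 0}}"
          using E_attach[of e u v j] e \<open>u \<in> e\<close> \<open>v \<in> e\<close> by blast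
      qed
      from card_mono[OF _ this] show "card ?X \<le> 1" by simp
    qed
    moreover have "card (wire_side False j) \<le> 6 * Suc N"
      using card_mono[OF fin_wires[of j], of "wire_side False j"] card_wires[of j]
      unfolding wire_side_def by auto
    ultimately show ?thesis
      unfolding c1_def by (elim tree_cost_le_mono) (simp add: card_blocks)
  qed
  have notHub: "Hub \<notin> wires N j" "Hub \<notin> blocks K j" for j by simp_all
  have idx: "idx v = j" if "v \<in> wires N j \<union> blocks K j" for v j
    using that by (auto elim!: wiresE blocksE)
  have A_sub: "A j \<subseteq> wires N j \<union> blocks K j" for j
    unfolding A_def wire_side_def by auto
  have W_sub: "wire_side b j \<subseteq> wires N j" for b j unfolding wire_side_def by auto
  have UA: "tree_cost_le f E (\<Union>j<m. A j) (m * c1)"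
  proof (rule tree_cost_le_UN[OF finite_E _ _ _ A empty])
    show "finite (A j)" for j unfolding A_def using fin_blocks fin_side by auto
    show "disjoint_family_on A {..<m}"
      unfolding disjoint_family_on_def using A_sub idx by (metis disjoint_iff subsetD)
    show "inj_on f (\<Union>j<m. A j)"
      unfolding A_def using blocks_core side_core by (intro inj' UN_least Un_least) simp_all
    show "j = k" if "e \<in> E" "u \<in> e \<inter> A j" "v \<in> e \<inter> A k" for e u v j k
      using E_idx[of e u v] that A_sub[of j] A_sub[of k] idx[of u j] idx[of v k] notHub
      by (metis IntD1 IntD2 UnE subsetD)
  qed
  have UW: "tree_cost_le f E (\<Union>j<m. wire_side True j) (m * (Suc N * (6 ^ 3 * Suc L)))"
  proof (rule tree_cost_le_UN[OF finite_E fin_side _ _ wire empty])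
    show "disjoint_family_on (wire_side True) {..<m}"
      unfolding disjoint_family_on_def using W_sub idx by (metis UnI1 disjoint_iff subsetD)
    show "inj_on f (\<Union>j<m. wire_side True j)"
      using side_core by (intro inj' UN_least) simp
    show "j = k" if "e \<in> E" "u \<in> e \<inter> wire_side True j" "v \<in> e \<inter> wire_side True k" for e u v j k
      using E_idx[of e u v] that W_sub[of True j] W_sub[of True k] idx[of u j] idx[of v k] notHub
      by (metis IntD1 IntD2 UnI1 subsetD)
  qed
  let ?W = "\<Union>j<m. wire_side True j"
  have card_W: "card ?W \<le> m * (6 * Suc N)"
  proof -
    have "card ?W \<le> (\<Sum>j<m. card (wire_side True j))" by (rule card_UN_le) simp
    also have "\<dots> \<le> (\<Sum>j<m. 6 * Suc N)"
      using card_mono[OF fin_wires W_sub] card_wires by (intro sum_mono) metis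
    finally show ?thesis by simp
  qed
  have hub_none: "{e \<in> E. e \<subseteq> {Hub}} = {}"
  proof (rule ccontr)
    assume "\<not> ?thesis"
    then obtain e where "e \<in> E" "e \<subseteq> {Hub}" by blast
    then show False using card_E[of e] card_mono[of "{Hub}" e] by simp
  qed
  have Hub: "tree_cost_le f E {Hub} 0"
    using tree_cost_le_flat[of "{Hub}" f E] unfolding hub_none by simp
  have HW: "tree_cost_le f E ({Hub} \<union> ?W) (0 + m * (Suc N * (6 ^ 3 * Suc L)) + m * (card {Hub} + card ?W))"
  proof (rule tree_cost_le_Un[OF Hub UW finite_E])
    show "finite ?W" using fin_side by auto
    show "{Hub} \<inter> ?W = {}" using notHub W_sub by blast
    show "inj_on f ({Hub} \<union> ?W)" using side_core by (intro inj' UN_least Un_least) (simp_all add: core_def)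
    have "{e \<in> E. e \<subseteq> {Hub} \<union> ?W \<and> \<not> e \<subseteq> {Hub} \<and> \<not> e \<subseteq> ?W} \<subseteq> (\<lambda>j. {Hub, Wire j N 0 False}) ` {..<m}" (is "?X \<subseteq> _")
      using E_Hub by fastforce
    then have "card ?X \<le> card ((\<lambda>j. {Hub, Wire j N 0 False}) ` {..<m})"
      by (intro card_mono) auto
    also have "\<dots> \<le> m" using card_image_le[of "{..<m}"] by fastforce
    finally show "card ?X \<le> m" .
  qed simp
  have cA: "(\<Union>j<m. A j) \<union> ({Hub} \<union> ?W) = core"
    unfolding A_def core_def wire_side_def by auto
  have core: "tree_cost_le f E core (m * c1 + (0 + m * (Suc N * (6 ^ 3 * Suc L)) + m * (card {Hub} + card ?W))
      + 0 * (card (\<Union>j<m. A j) + card ({Hub} \<union> ?W)))"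
    unfolding cA[symmetric]
  proof (rule tree_cost_le_Un[OF UA HW finite_E])
    show "finite (\<Union>j<m. A j)" unfolding A_def using fin_blocks fin_side by auto
    show "finite ({Hub} \<union> ?W)" using fin_side by auto
    show "(\<Union>j<m. A j) \<inter> ({Hub} \<union> ?W) = {}"
      unfolding A_def wire_side_def using wires_not_blocks notHub by auto
    show "inj_on f ((\<Union>j<m. A j) \<union> ({Hub} \<union> ?W))" unfolding cA by (rule inj') simp
    \<comment> \<open>A hub edge lies wholly in the hub part, because its wire end has side
      \<open>True\<close> by \<open>odd\<close>. Any other edge between the parts would join
      vertices of different sides, against \<open>E_side\<close>.\<close>
    have "False" if e: "e \<in> E" "\<not> e \<subseteq> (\<Union>j<m. A j)" "\<not> e \<subseteq> {Hub} \<union> ?W" "e \<subseteq> core" for e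
    proof -
      obtain u where u: "u \<in> e" "u \<notin> (\<Union>j<m. A j)" using e by blast
      obtain v where v: "v \<in> e" "v \<notin> {Hub} \<union> ?W" using e by blast
      have "v \<in> core" using v e(4) by blast
      then have "\<not> side x y v"
        using v(2) unfolding core_def wire_side_def by (auto elim!: blocksE)
      show False
      proof (cases "Hub \<in> e")
        case True
        obtain j where j: "j < m" "e = {Hub, Wire j N 0 False}" using E_Hub[OF e(1) True] by blast
        then have "v = Wire j N 0 False" using v by auto
        then show False using odd \<open>\<not> side x y v\<close> by simp
      next
        case False
        have "u \<in> core" "u \<noteq> Hub" using u e(4) False by blast+
        then have "side x y u"
          using u(2) unfolding core_def A_def wire_side_def by auto
        then show False using E_side[OF e(1) u(1) v(1)] \<open>\<not> side x y v\<close> u v False by auto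
      qed
    qed
    then have "{e \<in> E. e \<subseteq> (\<Union>j<m. A j) \<union> ({Hub} \<union> ?W) \<and> \<not> e \<subseteq> (\<Union>j<m. A j) \<and> \<not> e \<subseteq> {Hub} \<union> ?W} = {}"
      unfolding cA by blast
    then show "card {e \<in> E. e \<subseteq> (\<Union>j<m. A j) \<union> ({Hub} \<union> ?W) \<and> \<not> e \<subseteq> (\<Union>j<m. A j) \<and> \<not> e \<subseteq> {Hub} \<union> ?W} \<le> 0"
      by (simp only: card.empty)
  qed
  have spare_none: "{e \<in> E. e \<subseteq> V - core} = {}"
  proof (rule ccontr)
    assume "\<not> ?thesis"
    then obtain e where e: "e \<in> E" "e \<subseteq> V - core" by blast
    with E_core[OF e(1)] have "e = {}" by blast
    then show False using e(1) empty by simp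
  qed
  have spare: "tree_cost_le f E (V - core) 0"
    using tree_cost_le_flat[of "V - core" f E] inj_on_subset[OF inj, of "V - core"] V(3)
    unfolding spare_none by simp
  have Vc: "core \<union> (V - core) = V" using V(1) by blast
  have "tree_cost_le f E (core \<union> (V - core)) ((m * c1 + (0 + m * (Suc N * (6 ^ 3 * Suc L)) + m * (card {Hub} + card ?W))
      + 0 * (card (\<Union>j<m. A j) + card ({Hub} \<union> ?W))) + 0 + 0 * (card core + card (V - core)))"
  proof (rule tree_cost_le_Un[OF core spare finite_E finite_core])
    have "{e \<in> E. e \<subseteq> core \<union> (V - core) \<and> \<not> e \<subseteq> core \<and> \<not> e \<subseteq> V - core} = {}"
      using E_core by auto
    then show "card {e \<in> E. e \<subseteq> core \<union> (V - core) \<and> \<not> e \<subseteq> core \<and> \<not> e \<subseteq> V - core} \<le> 0"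
      by (simp only: card.empty)
  qed (use V inj Vc in auto)
  then have all: "tree_cost_le f E V ((m * c1 + (0 + m * (Suc N * (6 ^ 3 * Suc L)) + m * (card {Hub} + card ?W))
      + 0 * (card (\<Union>j<m. A j) + card ({Hub} \<union> ?W))) + 0 + 0 * (card core + card (V - core)))"
    unfolding Vc .
  \<comment> \<open>In units of \<open>m * K * Suc L\<close> the contributions are at most 224 from
    \<open>m * c1\<close>, 216 from the \<open>True\<close> sides and 7 from the hub edges, in total
    447.\<close>
  have le: "(m * c1 + (0 + m * (Suc N * (6 ^ 3 * Suc L)) + m * (card {Hub} + card ?W))) \<le> 450 * (m * K * Suc L)"
  proof -
    define Q where "Q = m * K * Suc L"
    have q1: "m * Suc N * Suc L \<le> Q"
    proof -
      have "m * Suc N * Suc L \<le> K * Suc L" using L(2) by (rule mult_right_mono) simp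
      also have "\<dots> \<le> m * (K * Suc L)" using m by simp
      finally show ?thesis unfolding Q_def by (simp only: mult.assoc)
    qed
    have q2: "m * K \<le> Q" unfolding Q_def by simp
    have q3: "m * Suc N \<le> Q" using q1 by (rule order_trans[rotated]) simp
    have q4: "m \<le> Q" using q3 by (rule order_trans[rotated]) simp
    have q5: "m * (m * Suc N) \<le> Q"
      using q2 L(2) by (meson mult_le_mono2 order_trans)
    have "m * card ?W \<le> m * (m * (6 * Suc N))" using card_W by (rule mult_left_mono) simp
    also have "\<dots> = 6 * (m * (m * Suc N))" by (simp only: ac_simps)
    finally have q6: "m * card ?W \<le> 6 * Q" using q5 by linarith
    have "m * c1 = Q + 216 * (m * Suc N * Suc L) + m * K + 6 * (m * Suc N)"
      unfolding c1_def Q_def by (simp add: algebra_simps)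
    moreover have "m * (Suc N * (6 ^ 3 * Suc L)) = 216 * (m * Suc N * Suc L)" by (simp add: algebra_simps)
    moreover have "m * (card {Hub} + card ?W) = m + m * card ?W" by simp
    ultimately show ?thesis using q1 q2 q3 q4 q6 unfolding Q_def[symmetric] by linarith
  qed
  show ?thesis
    by (rule tree_cost_le_mono[OF all]) (use le in simp)
qed

lemma graph:
  assumes "core \<subseteq> V" "bij_betw f V {0..<n}"
  shows "graph_on n ((`) f ` E)"
  unfolding graph_on_def
proof
  fix e' assume "e' \<in> (`) f ` E"
  then obtain e where e: "e \<in> E" "e' = f ` e" by blast
  obtain u v where uv: "e = {u, v}" "u \<noteq> v" using card_E[OF e(1)] unfolding card_2_iff by blast
  have "u \<in> V" "v \<in> V" using E_core[OF e(1)] assms(1) uv by auto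
  then have "f u \<noteq> f v" "f u < n" "f v < n"
    using assms(2) uv(2) unfolding bij_betw_def inj_on_def by auto
  then show "\<exists>u v. e' = {u, v} \<and> u \<noteq> v \<and> u < n \<and> v < n"
    using e(2) uv(1) by (intro exI[of _ "f u"] exI[of _ "f v"]) simp
qed

lemma OPT_upper:
  assumes odd: "swaps x y N" and V: "core \<subseteq> V" "V \<subseteq> core \<union> range Spare" "finite V"
    and f: "bij_betw f V {0..<n}" and L: "K \<le> 2 ^ L" "m * Suc N \<le> K" and m: "m > 0"
  shows "OPT n ((`) f ` E) \<le> 450 * (m * K * Suc L)"
proof (rule OPT_le_tree_cost[OF f])
  show "e \<subseteq> V" if "e \<in> E" for e using E_core[OF that] V(1) by blast
  show "graph_on n ((`) f ` E)" using graph[OF V(1) f] .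
  show "tree_cost_le f E V (450 * (m * K * Suc L))"
    by (rule tree_cost_upper[OF odd V _ L m]) (use f in \<open>simp add: bij_betw_def\<close>)
qed

text \<open>Closure of \<open>D\<close> under adjacency stands in for reachability. The walk from
  layer \<open>N\<close> down to \<open>0\<close> along the tracks \<open>swaps x y i\<close> starts
  at the hub's end because the parity is even, and it arrives at the attached end because
  \<open>swaps x y 0\<close> is false.\<close>

lemma connected_to_hub:
  assumes even: "\<not> swaps x y N" and j: "j < m"
    and D: "\<And>u v. alice K N x j u v \<or> bob N y j u v \<Longrightarrow> u \<in> D \<longleftrightarrow> v \<in> D" and "Hub \<in> D"
  shows "blocks K j \<subseteq> D"
proof -
  have step: "Wire j i 0 (swaps x y i) \<in> D" if "Wire j (Suc i) 0 (swaps x y (Suc i)) \<in> D" "i < N" for i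
  proof (cases "i \<in> x")
    case False
    then show ?thesis
      using D[of "Wire j i 0 (swaps x y i)" "Wire j (Suc i) 0 (swaps x y i)"] that
      by (simp add: swaps_Suc alice.intros)
  next
    case True
    let ?p = "swaps x y i"
    have "Wire j i 2 (?p \<noteq> (i \<in> y)) \<in> D"
      using D[of "Wire j i 2 (?p \<noteq> (i \<in> y))" "Wire j (Suc i) 0 (?p \<noteq> (i \<in> y))"] that True
      by (simp add: swaps_Suc alice.intros)
    then have "Wire j i 1 ?p \<in> D"
      using D[of "Wire j i 1 ?p" "Wire j i 2 (?p \<noteq> (i \<in> y))"] bob.intros[OF that(2), of y j ?p] by blast
    then show ?thesis
      using D[of "Wire j i 0 ?p" "Wire j i 1 ?p"] alice.enter[OF that(2) True] by blast
  qed
  have "Wire j N 0 (swaps x y N) \<in> D"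
    using even D[of Hub "Wire j N 0 False"] \<open>Hub \<in> D\<close> by (simp add: alice.hub)
  moreover have "Wire j i 0 (swaps x y i) \<in> D" if "i \<le> N" "Wire j N 0 (swaps x y N) \<in> D" for i
    using that by (induction rule: inc_induct) (auto intro: step)
  ultimately have "Wire j 0 0 False \<in> D" using swaps_0 by fastforce
  then have 0: "Block j 0 \<in> D" using D[OF disjI1[OF alice.attach]] by blast
  have "Block j i \<in> D" if "i < K" for i
    using that
  proof (induction i)
    case (Suc i)
    then show ?case using D[OF disjI1[OF alice.block[of i]]] by simp
  qed (simp add: 0)
  then show ?thesis unfolding blocks_def by auto
qed

text \<open>The star bound applies with the blocks as \<open>W j\<close>: if no edge of
  \<open>F j\<close> left \<open>D\<close>, the preimage of \<open>D\<close> would be closed under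
  adjacency in wire \<open>j\<close> and so contain its whole block.\<close>

lemma OPT_lower:
  assumes even: "\<not> swaps x y N" and V: "core \<subseteq> V"
    and f: "bij_betw f V {0..<n}" and m: "m > 0"
  shows "m * (m * K) \<le> 4 * OPT n ((`) f ` E)"
proof -
  obtain T where T: "hc_tree n T" "hc_cost ((`) f ` E) T = OPT n ((`) f ` E)"
    by (rule OPT_attained)
  have inj: "inj_on f V" and img: "f ` V = {0..<n}" using f by (auto simp: bij_betw_def)
  have sub: "blocks K j \<subseteq> V" if "j < m" for j using V that unfolding core_def by auto
  have Hub: "Hub \<in> V" using V unfolding core_def by auto
  have FV: "e \<subseteq> V" if "e \<in> F j" "j < m" for e j using F_core[OF that] V by blast
  have "m * (m * K) \<le> 4 * hc_cost ((`) f ` E) T"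
  proof (rule hc_cost_star_lower[where c = "f Hub" and W = "\<lambda>j. f ` blocks K j" and F = "\<lambda>j. (`) f ` F j", OF graph[OF V f] T(1)])
    show "f Hub < n" using Hub img by auto
    show "f ` blocks K j \<subseteq> {0..<n}" if "j < m" for j using sub[OF that] img by blast
    show "card (f ` blocks K j) = K" if "j < m" for j
      using card_image[OF inj_on_subset[OF inj sub[OF that]]] card_blocks by simp
    show "disjoint_family_on (\<lambda>j. f ` blocks K j) {..<m}"
      unfolding disjoint_family_on_def
    proof (intro ballI impI)
      fix i j assume "i \<in> {..<m}" "j \<in> {..<m}" "i \<noteq> j"
      moreover from this have "blocks K i \<inter> blocks K j = {}" unfolding blocks_def by auto
      ultimately show "f ` blocks K i \<inter> f ` blocks K j = {}"
        using inj_on_image_Int[OF inj sub sub, of i j] by simp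
    qed
    show "f Hub \<notin> f ` blocks K j" if "j < m" for j
      using inj_on_image_mem_iff[OF inj Hub sub[OF that]] by (auto simp: blocks_def)
    show "(`) f ` F j \<subseteq> (`) f ` E" if "j < m" for j using that unfolding E_def by auto
    show "disjoint_family_on (\<lambda>j. (`) f ` F j) {..<m}"
      unfolding disjoint_family_on_def
    proof (intro ballI impI)
      fix i j assume ij: "i \<in> {..<m}" "j \<in> {..<m}" "i \<noteq> j"
      then have "F i \<inter> F j = {}" using disjoint_family_onD[OF F_disjoint] by blast
      moreover have "inj_on ((`) f) (Pow V)" by (rule inj_on_image_Pow[OF inj])
      moreover have "F i \<subseteq> Pow V" "F j \<subseteq> Pow V" using FV ij by auto
      ultimately show "(`) f ` F i \<inter> (`) f ` F j = {}"
        by (metis image_empty inj_on_image_Int)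
    qed
    show "0 < m * K" using m K by simp
    show "\<exists>e\<in>(`) f ` F j. e \<inter> D \<noteq> {} \<and> \<not> e \<subseteq> D" if "j < m" "f Hub \<in> D" "\<not> f ` blocks K j \<subseteq> D" for j D
    proof (rule ccontr)
      assume no: "\<not> ?thesis"
      have "blocks K j \<subseteq> {v. f v \<in> D}"
      proof (rule connected_to_hub[OF even that(1)])
        fix u v assume "alice K N x j u v \<or> bob N y j u v"
        then have "{u, v} \<in> F j" unfolding F_def alice_edges_def bob_edges_def by blast
        then have "f ` {u, v} \<in> (`) f ` F j" by (rule imageI)
        with no have "f ` {u, v} \<inter> D = {} \<or> f ` {u, v} \<subseteq> D" by meson
        then show "u \<in> {v. f v \<in> D} \<longleftrightarrow> v \<in> {v. f v \<in> D}" by auto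
      qed (use that in auto)
      then show False using that(3) by blast
    qed
  qed
  then show ?thesis using T(2) by simp
qed

end

section \<open>Splitting the edge stream between two players\<close>

lemma edge_stream_exists:
  assumes "graph_on n E"
  shows "\<exists>xs. edge_stream E xs"
proof -
  obtain es where es: "distinct es" "set es = E"
    using finite_distinct_list[OF graph_on_finite[OF assms]] by blast
  have "\<exists>p. (\<lambda>(u, v). {u, v}) p = e" if e: "e \<in> E" for e
  proof -
    obtain u v where "e = {u, v}" using graph_onE[OF assms e] by metis
    then show ?thesis by (intro exI[of _ "(u, v)"]) simp
  qed
  then obtain g where g: "\<And>e. e \<in> E \<Longrightarrow> (\<lambda>(u, v). {u, v}) (g e) = e" by metis
  have "map (\<lambda>(u, v). {u, v}) (map g es) = es"
    unfolding map_map by (rule map_idI) (use g es(2) in simp)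
  then have "edge_stream E (map g es)"
    unfolding edge_stream_def using es by (simp only:)
  then show ?thesis by blast
qed

lemma edge_stream_append:
  "edge_stream E xs \<Longrightarrow> edge_stream E' ys \<Longrightarrow> E \<inter> E' = {} \<Longrightarrow> edge_stream (E \<union> E') (xs @ ys)"
  unfolding edge_stream_def by simp

text \<open>The list \<open>la x\<close> sees only \<open>x\<close> and \<open>lb y\<close> only
  \<open>y\<close>, as a two-party protocol requires. One numbering \<open>f\<close> serves all
  inputs because the vertex set depends on neither of them.\<close>

lemma hard_instances:
  assumes m: "m > 0" and K: "K > 0" "m * Suc N \<le> K" "K \<le> 2 ^ L" and n: "1 + m * K + 6 * m * Suc N \<le> n"
  obtains la lb :: "nat set \<Rightarrow> (nat \<times> nat) list" and G :: "nat set \<Rightarrow> nat set \<Rightarrow> nat set set"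
  where "\<And>x y. graph_on n (G x y)" "\<And>x y. edge_stream (G x y) (la x @ lb y)"
    "\<And>x y. x \<subseteq> {..<N} \<Longrightarrow> odd (card (x \<inter> y)) \<Longrightarrow> OPT n (G x y) \<le> 450 * (m * K * Suc L)"
    "\<And>x y. x \<subseteq> {..<N} \<Longrightarrow> even (card (x \<inter> y)) \<Longrightarrow> m * (m * K) \<le> 4 * OPT n (G x y)"
proof -
  have loc: "gadget K" using K by unfold_locales
  define core where "core = gadget.core m K N"
  note core_eq = core_def[symmetric]
  \<comment> \<open>Isolated spare vertices pad the graph to exactly \<open>n\<close>
    vertices.\<close>
  define V where "V = core \<union> Spare ` {..<n - card core}"
  have "finite core" unfolding core_def using gadget.finite_core[OF loc] .
  have "core \<inter> range Spare = {}"
    unfolding core_def gadget.core_def[OF loc] blocks_def wires_def by auto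
  then have "card V = card core + card (Spare ` {..<n - card core})"
    unfolding V_def using \<open>finite core\<close> by (intro card_Un_disjoint) auto
  also have "card (Spare ` {..<n - card core}) = n - card core"
    by (subst card_image) (auto simp: inj_on_def)
  also have "card core + (n - card core) = n"
    using gadget.card_core[OF loc, of m N] n unfolding core_def by simp
  finally have "card V = n" .
  have V: "core \<subseteq> V" "V \<subseteq> core \<union> range Spare" "finite V"
    unfolding V_def using \<open>finite core\<close> by auto
  then obtain f where f: "bij_betw f V {0..<n}"
    using ex_bij_betw_finite_nat \<open>card V = n\<close> by metis
  define GA where "GA = (\<lambda>x. (`) f ` (\<Union>j<m. alice_edges K N x j))"
  define GB where "GB = (\<lambda>y. (`) f ` (\<Union>j<m. bob_edges N y j))"
  define G where "G = (\<lambda>x y. GA x \<union> GB y)"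
  have G_eq: "G x y = (`) f ` gadget.E m K N x y" for x y
    unfolding G_def GA_def GB_def gadget.E_def[OF loc] gadget.F_def[OF loc] by blast
  have graph: "graph_on n (G x y)" for x y
    unfolding G_eq by (rule gadget.graph[OF loc V(1)[unfolded core_def] f])
  have sub: "graph_on n X" if "X \<subseteq> G x y" for X x y
    using graph[of x y] that unfolding graph_on_def by (meson subsetD)
  have "\<exists>xs. edge_stream (GA x) xs" for x
    by (rule edge_stream_exists[OF sub[of _ x "{}"]]) (simp add: G_def)
  then obtain la where la: "\<And>x. edge_stream (GA x) (la x)" by metis
  have "\<exists>xs. edge_stream (GB y) xs" for y
    by (rule edge_stream_exists[OF sub[of _ "{}" y]]) (simp add: G_def)
  then obtain lb where lb: "\<And>y. edge_stream (GB y) (lb y)" by metis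
  have disj: "GA x \<inter> GB y = {}" for x y
  proof -
    let ?A = "\<Union>j<m. alice_edges K N x j" and ?B = "\<Union>j<m. bob_edges N y j"
    have "?A \<inter> ?B = {}"
      unfolding alice_edges_def bob_edges_def
      using alice_bob_disjoint by fast
    moreover have "?A \<subseteq> Pow V" "?B \<subseteq> Pow V"
      using gadget.E_core[OF loc, of _ m N x y] V(1) core_def
      unfolding gadget.E_def[OF loc] gadget.F_def[OF loc] by blast+
    moreover have "inj_on ((`) f) (Pow V)"
      using f by (intro inj_on_image_Pow) (simp add: bij_betw_def)
    ultimately show ?thesis
      unfolding GA_def GB_def by (metis image_empty inj_on_image_Int)
  qed
  show ?thesis
  proof (rule that[OF graph])
    show "edge_stream (G x y) (la x @ lb y)" for x y
      unfolding G_def by (rule edge_stream_append[OF la lb disj])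
    show "OPT n (G x y) \<le> 450 * (m * K * Suc L)" if "x \<subseteq> {..<N}" "odd (card (x \<inter> y))" for x y
      unfolding G_eq using that K m
      by (intro gadget.OPT_upper[OF loc _ V[unfolded core_def] f]) (simp_all add: swaps_full)
    show "m * (m * K) \<le> 4 * OPT n (G x y)" if "x \<subseteq> {..<N}" "even (card (x \<inter> y))" for x y
      unfolding G_eq using that m
      by (intro gadget.OPT_lower[OF loc _ V(1)[unfolded core_def] f]) (simp_all add: swaps_full)
  qed
qed

section \<open>Discrepancy and streaming\<close>

text \<open>Over the subsets of a finite set these are the entries of the Sylvester-Hadamard
  matrix.\<close>

definition ip_sign :: "'a set \<Rightarrow> 'a set \<Rightarrow> real" where
  "ip_sign x y = (- 1) ^ card (x \<inter> y)"

lemma ip_sign_toggle: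
  assumes "finite x"
  shows "ip_sign x (if i \<in> y then y - {i} else insert i y) = (if i \<in> x then - ip_sign x y else ip_sign x y)"
proof (cases "i \<in> x")
  case False
  then have "x \<inter> (if i \<in> y then y - {i} else insert i y) = x \<inter> y" by auto
  then show ?thesis using False unfolding ip_sign_def by simp
next
  case True
  show ?thesis
  proof (cases "i \<in> y")
    case i: True
    have "x \<inter> y = insert i (x \<inter> (y - {i}))" using True i by auto
    then have "card (x \<inter> y) = Suc (card (x \<inter> (y - {i})))"
      using assms by (metis Diff_iff IntE card_insert_disjoint finite_Int insertI1)
    then show ?thesis using True i unfolding ip_sign_def by simp
  next
    case i: False
    have "x \<inter> insert i y = insert i (x \<inter> y)" using True by auto
    then have "card (x \<inter> insert i y) = Suc (card (x \<inter> y))"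
      using assms i by simp
    then show ?thesis using True i unfolding ip_sign_def by simp
  qed
qed

text \<open>For \<open>x \<noteq> x'\<close>, toggling an element on which they differ is an
  involution of \<open>Pow U\<close> that flips the sign of every product, so the sum equals its own
  negative.\<close>

lemma sum_ip_sign_orthogonal:
  assumes "finite U" "x \<subseteq> U" "x' \<subseteq> U"
  shows "(\<Sum>y\<in>Pow U. ip_sign x y * ip_sign x' y) = (if x = x' then 2 ^ card U else 0)"
proof (cases "x = x'")
  case True
  then show ?thesis
    using assms by (simp add: ip_sign_def card_Pow flip: power_add mult_2)
next
  case False
  then obtain i where i: "i \<in> U" "(i \<in> x) \<noteq> (i \<in> x')" using assms by blast
  let ?h = "\<lambda>y. if i \<in> y then y - {i} else insert i y"
  have fin: "finite x" "finite x'" using assms finite_subset by blast+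
  have "(\<Sum>y\<in>Pow U. ip_sign x y * ip_sign x' y) = (\<Sum>y\<in>Pow U. ip_sign x (?h y) * ip_sign x' (?h y))"
    by (rule sum.reindex_bij_witness[of _ ?h ?h]) (use i in \<open>auto simp: insert_absorb\<close>)
  also have "\<dots> = (\<Sum>y\<in>Pow U. - (ip_sign x y * ip_sign x' y))"
    using i(2) by (intro sum.cong refl) (auto simp: ip_sign_toggle fin)
  finally show ?thesis using False by (simp add: sum_negf)
qed

text \<open>Cauchy-Schwarz over the columns in \<open>B\<close>, then extension of the sum of
  squares to all columns, where orthogonality leaves \<open>card A * 2 ^ card U\<close>. Each of
  \<open>card A\<close> and \<open>card B\<close> is at most \<open>2 ^ card U\<close>.\<close>

lemma lindsey:
  assumes "finite U" "A \<subseteq> Pow U" "B \<subseteq> Pow U"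
  shows "\<bar>\<Sum>x\<in>A. \<Sum>y\<in>B. ip_sign x y\<bar> \<le> sqrt (8 ^ card U)"
proof -
  have fin: "finite A" "finite B" using assms finite_subset finite_Pow_iff by metis+
  have card: "real (card X) \<le> 2 ^ card U" if "X \<subseteq> Pow U" for X
  proof -
    have "card X \<le> 2 ^ card U"
      using card_mono[OF _ that] assms(1) by (simp add: card_Pow)
    then show ?thesis by (metis of_nat_le_iff of_nat_numeral of_nat_power)
  qed
  have "(\<Sum>y\<in>Pow U. (\<Sum>x\<in>A. ip_sign x y)\<^sup>2) = (\<Sum>y\<in>Pow U. \<Sum>x\<in>A. \<Sum>x'\<in>A. ip_sign x y * ip_sign x' y)"
    by (simp add: power2_eq_square sum_product)
  also have "\<dots> = (\<Sum>x\<in>A. \<Sum>x'\<in>A. \<Sum>y\<in>Pow U. ip_sign x y * ip_sign x' y)"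
    by (subst sum.swap, rule sum.cong[OF refl], rule sum.swap)
  also have "\<dots> = (\<Sum>x\<in>A. \<Sum>x'\<in>A. if x = x' then 2 ^ card U else 0)"
    using assms by (intro sum.cong refl sum_ip_sign_orthogonal) auto
  also have "\<dots> = card A * 2 ^ card U"
    using fin by simp
  finally have *: "(\<Sum>y\<in>Pow U. (\<Sum>x\<in>A. ip_sign x y)\<^sup>2) = card A * 2 ^ card U" .
  have "(\<Sum>x\<in>A. \<Sum>y\<in>B. ip_sign x y)\<^sup>2 = (\<Sum>y\<in>B. 1 * (\<Sum>x\<in>A. ip_sign x y))\<^sup>2"
    by (subst sum.swap) simp
  also have "\<dots> \<le> (\<Sum>y\<in>B. 1\<^sup>2) * (\<Sum>y\<in>B. (\<Sum>x\<in>A. ip_sign x y)\<^sup>2)"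
    by (rule Cauchy_Schwarz_ineq_sum)
  also have "\<dots> \<le> (\<Sum>y\<in>B. 1\<^sup>2) * (\<Sum>y\<in>Pow U. (\<Sum>x\<in>A. ip_sign x y)\<^sup>2)"
    using assms by (intro mult_left_mono sum_mono2) auto
  also have "\<dots> \<le> 2 ^ card U * (2 ^ card U * 2 ^ card U)"
    unfolding * using card[OF assms(2)] card[OF assms(3)] by (intro mult_mono) auto
  also have "\<dots> = 8 ^ card U"
    by (simp flip: power_mult_distrib)
  finally show ?thesis
    by (metis real_sqrt_abs real_sqrt_le_mono)
qed

text \<open>The messages exchanged in a fixed transcript are consistent with exactly a combinatorial
  rectangle of inputs, so the correlation of the outcome with the inner product is at most the number of
  transcripts times the discrepancy of a rectangle.\<close>

lemma protocol_correlation: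
  fixes r :: "'a set \<Rightarrow> 'a set \<Rightarrow> nat \<Rightarrow> 's"
  assumes U: "finite U" and M: "finite M"
    and r0: "\<And>x y. r x y 0 = s0"
    and rSuc: "\<And>x y i. r x y (Suc i) = b i y (a i x (r x y i))"
    and aM: "\<And>x y i. a i x (r x y i) \<in> M" and rM: "\<And>x y i. r x y i \<in> M"
    and g: "\<And>s. \<bar>g s\<bar> \<le> 1"
  shows "(\<Sum>(x, y)\<in>Pow U \<times> Pow U. g (r x y p) * ip_sign x y) \<le> real (card M) ^ (2 * p) * sqrt (8 ^ card U)"
proof -
  define tr where "tr = (\<lambda>(x, y). map (\<lambda>i. (a i x (r x y i), r x y (Suc i))) [0..<p])"
  define TT where "TT = {t. set t \<subseteq> M \<times> M \<and> length t = p}"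
  \<comment> \<open>The state before round \<open>i\<close> as recorded in the transcript; round
    \<open>0\<close> has no predecessor and starts from \<open>s0\<close>.\<close>
  define st where "st = (\<lambda>(t :: ('s \<times> 's) list) i. if i = 0 then s0 else snd (t ! (i - 1)))"
  define A where "A = (\<lambda>t. {x\<in>Pow U. \<forall>i<p. a i x (st t i) = fst (t ! i)})"
  define B where "B = (\<lambda>t. {y\<in>Pow U. \<forall>i<p. b i y (fst (t ! i)) = snd (t ! i)})"
  have finTT: "finite TT" and cardTT: "card TT = card M ^ (2 * p)"
    unfolding TT_def using M
    by (auto simp: finite_lists_length_eq card_lists_length_eq card_cartesian_product power_mult power2_eq_square)
  have st_tr: "st (tr (x, y)) i = r x y i" if "i \<le> p" for x y i
    using that unfolding st_def tr_def by (auto simp: r0)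
  \<comment> \<open>If the replies of each player, computed from the recorded states, agree with
    \<open>t\<close> in every round, then by induction on the rounds the actual run follows
    \<open>t\<close>.\<close>
  have fib: "{xy \<in> Pow U \<times> Pow U. tr xy = t} = A t \<times> B t" if t: "t \<in> TT" for t
  proof (intro set_eqI, clarify)
    fix x y
    have "x \<in> A t \<and> y \<in> B t" if "x \<in> Pow U" "y \<in> Pow U" "tr (x, y) = t"
    proof -
      have "t ! i = (a i x (r x y i), r x y (Suc i))" if "i < p" for i
        using that \<open>tr (x, y) = t\<close> unfolding tr_def by auto
      then show ?thesis
        using that st_tr[of _ x y] unfolding A_def B_def by (auto simp: rSuc)
    qed
    moreover have "tr (x, y) = t" if "x \<in> A t" "y \<in> B t"
    proof -
      have run: "r x y i = st t i" if "i \<le> p" for i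
        using that
      proof (induction i)
        case 0
        show ?case by (simp add: r0 st_def)
      next
        case (Suc i)
        then show ?case
          using \<open>x \<in> A t\<close> \<open>y \<in> B t\<close> unfolding A_def B_def by (simp add: rSuc) (simp add: st_def)
      qed
      have "tr (x, y) ! i = t ! i" if "i < p" for i
        using that run[of i] run[of "Suc i"] \<open>x \<in> A t\<close> unfolding A_def
        by (simp add: tr_def prod_eq_iff) (simp add: st_def)
      then show ?thesis
        using t by (intro nth_equalityI) (auto simp: tr_def TT_def)
    qed
    ultimately show "(x, y) \<in> {xy \<in> Pow U \<times> Pow U. tr xy = t} \<longleftrightarrow> (x, y) \<in> A t \<times> B t"
      unfolding A_def B_def by auto
  qed
  have img: "tr ` (Pow U \<times> Pow U) \<subseteq> TT"
    unfolding TT_def tr_def using aM rM by auto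
  have "(\<Sum>(x, y)\<in>Pow U \<times> Pow U. g (r x y p) * ip_sign x y)
      = (\<Sum>t\<in>TT. \<Sum>(x, y)\<in>{xy \<in> Pow U \<times> Pow U. tr xy = t}. g (r x y p) * ip_sign x y)"
    using U img finTT by (subst sum.group) auto
  also have "\<dots> = (\<Sum>t\<in>TT. g (st t p) * (\<Sum>x\<in>A t. \<Sum>y\<in>B t. ip_sign x y))"
  proof (rule sum.cong[OF refl])
    fix t assume t: "t \<in> TT"
    have "(\<Sum>(x, y)\<in>{xy \<in> Pow U \<times> Pow U. tr xy = t}. g (r x y p) * ip_sign x y)
        = (\<Sum>(x, y)\<in>{xy \<in> Pow U \<times> Pow U. tr xy = t}. g (st t p) * ip_sign x y)"
      by (rule sum.cong[OF refl]) (auto simp: st_tr)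
    also have "\<dots> = g (st t p) * (\<Sum>x\<in>A t. \<Sum>y\<in>B t. ip_sign x y)"
      unfolding fib[OF t] by (simp add: sum.cartesian_product sum_distrib_left case_prod_unfold)
    finally show "(\<Sum>(x, y)\<in>{xy \<in> Pow U \<times> Pow U. tr xy = t}. g (r x y p) * ip_sign x y) = \<dots>" .
  qed
  also have "\<dots> \<le> of_nat (card TT) * sqrt (8 ^ card U)"
  proof (rule sum_bounded_above)
    fix t assume "t \<in> TT"
    have "\<bar>\<Sum>x\<in>A t. \<Sum>y\<in>B t. ip_sign x y\<bar> \<le> sqrt (8 ^ card U)"
      by (rule lindsey[OF U]) (auto simp: A_def B_def)
    then have "\<bar>g (st t p)\<bar> * \<bar>\<Sum>x\<in>A t. \<Sum>y\<in>B t. ip_sign x y\<bar> \<le> 1 * sqrt (8 ^ card U)"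
      using g by (intro mult_mono) auto
    then show "g (st t p) * (\<Sum>x\<in>A t. \<Sum>y\<in>B t. ip_sign x y) \<le> sqrt (8 ^ card U)"
      by (simp only: abs_mult[symmetric])
  qed
  finally show ?thesis by (simp add: cardTT)
qed

section \<open>Streaming algorithms as two-party protocols\<close>

text \<open>Memories of all lengths up to \<open>s\<close> are allowed, hence the exponent
  \<open>Suc s\<close> in the bounds below.\<close>

lemma card_bool_lists_le:
  "finite {l :: bool list. length l \<le> s}" "card {l :: bool list. length l \<le> s} \<le> 2 ^ Suc s"
proof -
  have eq: "{l :: bool list. length l \<le> s} = {l. set l \<subseteq> UNIV \<and> length l \<le> s}" by simp
  show "finite {l :: bool list. length l \<le> s}"
    unfolding eq by (rule finite_lists_length_le) simp
  have "card {l :: bool list. length l \<le> s} = (\<Sum>i\<le>s. 2 ^ i)"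
    unfolding eq by (subst card_lists_length_le) (simp_all add: card_UNIV_bool)
  also have "\<dots> = (\<Sum>i<Suc s. 2 ^ i)" by (simp only: lessThan_Suc_atMost)
  also have "\<dots> \<le> 2 ^ Suc s" by (induction s) auto
  finally show "card {l :: bool list. length l \<le> s} \<le> 2 ^ Suc s" .
qed

lemma length_foldl_upd_le:
  assumes "uses_space s A" "length m \<le> s"
  shows "length (foldl (s_upd A i) m xs) \<le> s"
  using assms(2)
proof (induction xs arbitrary: m)
  case (Cons e xs)
  have "length (s_upd A i m e) \<le> s" using assms(1) unfolding uses_space_def by blast
  then show ?case using Cons.IH by simp
qed simp

lemma length_run_passes_le:
  assumes "uses_space s A"
  shows "length (run_passes A xs i) \<le> s"
proof (induction i)
  case 0
  then show ?case using assms unfolding uses_space_def by simp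
next
  case (Suc i)
  then show ?case using length_foldl_upd_le[OF assms] by simp
qed

text \<open>Each pass amounts to two messages, the memory after \<open>la x\<close> and the memory
  after \<open>lb y\<close>; this gives \<open>2 * p\<close> messages with at most
  \<open>2 ^ Suc s\<close> values each.\<close>

lemma stream_correlation:
  assumes U: "finite U" and A: "uses_space s A" and g: "\<And>z. \<bar>g z\<bar> \<le> 1"
  shows "(\<Sum>(x, y)\<in>Pow U \<times> Pow U. g (stream_output A p (la x @ lb y)) * ip_sign x y)
    \<le> 2 ^ (2 * p * Suc s) * sqrt (8 ^ card U)"
proof -
  let ?M = "{l :: bool list. length l \<le> s}"
  have "(\<Sum>(x, y)\<in>Pow U \<times> Pow U. g (s_out A (run_passes A (la x @ lb y) p)) * ip_sign x y)
      \<le> real (card ?M) ^ (2 * p) * sqrt (8 ^ card U)"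
    by (rule protocol_correlation[where b = "\<lambda>i y m. foldl (s_upd A i) m (lb y)"
          and a = "\<lambda>i x m. foldl (s_upd A i) m (la x)" and ?s0.0 = "s_init A" and g = "\<lambda>m. g (s_out A m)"])
      (simp_all add: U g card_bool_lists_le length_foldl_upd_le length_run_passes_le A)
  also have "real (card ?M) \<le> 2 ^ Suc s"
    using card_bool_lists_le(2)[of s] by (metis of_nat_le_iff of_nat_numeral of_nat_power)
  then have "real (card ?M) ^ (2 * p) * sqrt (8 ^ card U) \<le> (2 ^ Suc s) ^ (2 * p) * sqrt (8 ^ card U)"
    by (intro mult_right_mono power_mono) auto
  also have "(2 ^ Suc s) ^ (2 * p) = (2 :: real) ^ (2 * p * Suc s)"
    by (simp only: power_mult[symmetric] mult.commute)
  finally show ?thesis unfolding stream_output_def .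
qed

text \<open>Averaging over the random tape: success probability \<open>2 / 3\<close> is an advantage
  of at least \<open>1 / 3\<close> on every input pair, so the expected total correlation is at
  least \<open>4 ^ card U / 3\<close>. A single algorithm of this size cannot exceed the bound from
  \<open>stream_correlation\<close>.\<close>

lemma stream_inner_product_lower_bound:
  assumes U: "finite U" and R: "\<And>A. A \<in> set_pmf R \<Longrightarrow> uses_space s A"
    and correct: "\<And>x y. x \<subseteq> U \<Longrightarrow> y \<subseteq> U \<Longrightarrow>
      measure_pmf.prob R {A. stream_output A p (la x @ lb y) \<le> \<theta> \<longleftrightarrow> odd (card (x \<inter> y))} \<ge> 2 / 3"
  shows "card U \<le> 4 * p * Suc s + 4"
proof -
  define G where "G = (\<lambda>(x, y). {A. stream_output A p (la x @ lb y) \<le> \<theta> \<longleftrightarrow> odd (card (x \<inter> y))})"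
  let ?P = "Pow U \<times> Pow U"
  let ?B = "2 ^ (2 * p * Suc s) * sqrt (8 ^ card U)"
  have cardP: "real (card ?P) = 4 ^ card U"
    using U by (simp add: card_cartesian_product card_Pow flip: power_mult_distrib)
  have le: "(\<Sum>z\<in>?P. 2 * indicator (G z) A - 1) \<le> ?B" if "A \<in> set_pmf R" for A
  proof -
    \<comment> \<open>With these signs the product with \<open>ip_sign\<close> is \<open>1\<close>
      if the comparison with \<open>\<theta>\<close> predicts the parity correctly, and
      \<open>-1\<close> otherwise.\<close>
    let ?g = "\<lambda>z. if z \<le> \<theta> then - 1 else 1 :: real"
    have "(\<Sum>z\<in>?P. 2 * indicator (G z) A - 1) =
        (\<Sum>(x, y)\<in>?P. ?g (stream_output A p (la x @ lb y)) * ip_sign x y)"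
      by (rule sum.cong[OF refl]) (auto simp: G_def ip_sign_def indicator_def split: if_splits)
    also have "\<dots> \<le> ?B"
      by (rule stream_correlation[OF U R[OF that]]) auto
    finally show ?thesis .
  qed
  have ind: "integrable (measure_pmf R) (indicator X :: salg \<Rightarrow> real)" for X
    by (rule integrable_real_indicator) (auto simp: less_top[symmetric])
  have int: "integrable (measure_pmf R) (\<lambda>A. \<Sum>z\<in>?P. 2 * indicator (G z) A - 1 :: real)"
    by (intro Bochner_Integration.integrable_sum Bochner_Integration.integrable_diff integrable_mult_right ind) auto
  have "4 ^ card U / 3 = (\<Sum>z\<in>?P. 1 / 3 :: real)" using cardP by simp
  also have "\<dots> \<le> (\<Sum>z\<in>?P. 2 * measure_pmf.prob R (G z) - 1)"
  proof (rule sum_mono)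
    fix z assume "z \<in> ?P"
    then show "1 / 3 \<le> 2 * measure_pmf.prob R (G z) - 1"
      using correct[of "fst z" "snd z"] by (auto simp: G_def case_prod_unfold)
  qed
  also have "\<dots> = measure_pmf.expectation R (\<lambda>A. \<Sum>z\<in>?P. 2 * indicator (G z) A - 1)"
    by (subst Bochner_Integration.integral_sum) (auto simp: ind)
  also have "\<dots> \<le> ?B"
    by (rule measure_pmf.integral_le_const[OF int]) (use le in \<open>simp only: AE_measure_pmf_iff, blast\<close>)
  finally have "4 ^ card U / 3 \<le> ?B" .
  then have "(4 ^ card U / 3)\<^sup>2 \<le> ?B\<^sup>2" by (intro power_mono) auto
  also have "?B\<^sup>2 = 2 ^ (4 * p * Suc s) * 8 ^ card U"
  proof -
    have "(2 ^ (2 * p * Suc s))\<^sup>2 = (2 :: real) ^ (4 * p * Suc s)"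
      by (subst power_mult[symmetric], rule arg_cong[of _ _ "(^) 2"]) simp
    then show ?thesis by (simp only: power_mult_distrib) simp
  qed
  also have "(4 ^ card U / 3)\<^sup>2 = (16 :: real) ^ card U / 9"
    by (simp add: power_divide power2_eq_square flip: power_mult_distrib)
  finally have "16 ^ card U / 9 \<le> 2 ^ (4 * p * Suc s) * (8 :: real) ^ card U" .
  then have "2 ^ card U * 8 ^ card U \<le> 9 * 2 ^ (4 * p * Suc s) * (8 :: real) ^ card U"
    by (simp flip: power_mult_distrib)
  then have "2 ^ card U \<le> 9 * (2 :: real) ^ (4 * p * Suc s)"
    by simp
  \<comment> \<open>The additive 4 comes from \<open>9 \<le> 2 ^ 4\<close>.\<close>
  also have "\<dots> \<le> 2 ^ (4 * p * Suc s + 4)"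
    by (simp add: power_add)
  finally show ?thesis by (simp only: power_increasing_iff)
qed

section \<open>The lower bound\<close>

text \<open>The hypothesis on \<open>\<alpha>\<close> keeps the inflated cost of odd instances below
  the cost of even ones, \<open>1800\<close> being \<open>4 * 450\<close>. A correct estimate
  therefore reveals the parity of the intersection.\<close>

lemma space_lower_bound:
  assumes alg: "estimates_OPT n p s \<alpha> R"
    and m: "m > 0" and K: "K > 0" "m * Suc N \<le> K" "K \<le> 2 ^ L"
    and n: "1 + m * K + 6 * m * Suc N \<le> n" and \<alpha>: "\<bar>\<alpha>\<bar> * (1800 * real (Suc L)) < real m"
  shows "N \<le> 4 * p * Suc s + 4"
proof -
  obtain la lb :: "nat set \<Rightarrow> (nat \<times> nat) list" and G :: "nat set \<Rightarrow> nat set \<Rightarrow> nat set set"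
    where G: "\<And>x y. graph_on n (G x y)" "\<And>x y. edge_stream (G x y) (la x @ lb y)"
    and odd: "\<And>x y. x \<subseteq> {..<N} \<Longrightarrow> odd (card (x \<inter> y)) \<Longrightarrow> OPT n (G x y) \<le> 450 * (m * K * Suc L)"
    and even: "\<And>x y. x \<subseteq> {..<N} \<Longrightarrow> even (card (x \<inter> y)) \<Longrightarrow> m * (m * K) \<le> 4 * OPT n (G x y)"
    using hard_instances[OF m K n] by metis
  \<comment> \<open>An upper bound for correct outputs on odd instances; the absolute value is there
    because the sign of \<open>\<alpha>\<close> is not fixed.\<close>
  define \<theta> where "\<theta> = \<bar>\<alpha>\<bar> * real (450 * (m * K * Suc L))"
  have gap: "4 * \<theta> < real (m * (m * K))"
  proof -
    have "4 * \<theta> = (\<bar>\<alpha>\<bar> * (1800 * real (Suc L))) * real (m * K)"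
      unfolding \<theta>_def by (simp add: algebra_simps)
    also have "\<dots> < real m * real (m * K)"
      using \<alpha> m K by (intro mult_strict_right_mono) auto
    finally show ?thesis by simp
  qed
  have "card {..<N} \<le> 4 * p * Suc s + 4"
  proof (rule stream_inner_product_lower_bound)
    show "uses_space s A" if "A \<in> set_pmf R" for A
      using alg that unfolding estimates_OPT_def by blast
    show "2 / 3 \<le> measure_pmf.prob R {A. (stream_output A p (la x @ lb y) \<le> \<theta>) = odd (card (x \<inter> y))}"
      if "x \<subseteq> {..<N}" for x y
    proof -
      let ?out = "\<lambda>A. stream_output A p (la x @ lb y)" and ?O = "real (OPT n (G x y))"
      have "2 / 3 \<le> measure_pmf.prob R {A. ?O \<le> ?out A \<and> ?out A \<le> \<alpha> * ?O}"
        using alg G unfolding estimates_OPT_def by blast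
      also have "\<dots> \<le> measure_pmf.prob R {A. (?out A \<le> \<theta>) = odd (card (x \<inter> y))}"
      proof (rule measure_pmf.finite_measure_mono)
        show "{A. ?O \<le> ?out A \<and> ?out A \<le> \<alpha> * ?O} \<subseteq> {A. (?out A \<le> \<theta>) = odd (card (x \<inter> y))}"
        proof (rule subsetI, rule CollectI, drule CollectD, elim conjE)
          fix A assume A: "?O \<le> ?out A" "?out A \<le> \<alpha> * ?O"
          show "(?out A \<le> \<theta>) = odd (card (x \<inter> y))"
          proof (cases "odd (card (x \<inter> y))")
            case True
            have "\<alpha> * ?O \<le> \<bar>\<alpha>\<bar> * ?O" by (intro mult_right_mono) auto
            also have "\<dots> \<le> \<theta>"
              unfolding \<theta>_def using odd[OF that True] by (intro mult_left_mono of_nat_mono) auto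
            finally show ?thesis using A True by simp
          next
            case False
            then have "real (m * (m * K)) \<le> real (4 * OPT n (G x y))"
              using even[OF that] by (intro of_nat_mono) simp
            then have "\<theta> < ?O" using gap by simp
            then show ?thesis using A False by simp
          qed
        qed
      qed simp
      finally show ?thesis .
    qed
  qed simp
  then show ?thesis by simp
qed

theorem theorem4p1:
  fixes R :: "nat \<Rightarrow> salg pmf"
    and p :: "nat \<Rightarrow> nat" and s :: "nat \<Rightarrow> nat" and alpha :: "nat \<Rightarrow> real"
  assumes passes: "\<exists>c::nat. (\<lambda>n. real (p n)) \<in> O(\<lambda>n. ln (real n) ^ c)"
    and ratio: "alpha \<in> o(\<lambda>n. ln (real n) / ln (ln (real n)))"
    and alg: "\<And>n. estimates_OPT n (p n) (s n) (alpha n) (R n)"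
  shows "\<exists>c::nat. (\<lambda>n. real (s n)) \<in> \<Omega>(\<lambda>n. real n / ln (real n) ^ c)"
proof -
  obtain c where "(\<lambda>n. real (p n)) \<in> O(\<lambda>n. ln (real n) ^ c)"
    using passes by blast
  then obtain C where C: "C > 0" "\<forall>\<^sub>F n in at_top. norm (real (p n)) \<le> C * norm (ln (real n) ^ c)"
    by (rule landau_o.bigE)
  \<comment> \<open>The little-o bound is taken with constant \<open>1\<close>; once
    \<open>ln (ln n) \<ge> 1\<close>, it yields
    \<open>\<bar>alpha n\<bar> \<le> ln n\<close>.\<close>
  have \<alpha>: "\<forall>\<^sub>F n in at_top. norm (alpha n) \<le> 1 * norm (ln (real n) / ln (ln (real n)))"
    using landau_o.smallD[OF ratio, of 1] by simp
  \<comment> \<open>\<open>21601 = 1800 * 3 * 4 + 1\<close>, from \<open>L \<le> 3 * X\<close> and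
    \<open>Suc L \<le> 4 * X\<close> in the bound for \<open>m\<close>.\<close>
  define a :: real where "a = 21601"
  \<comment> \<open>\<open>128 = 16 * 4 * 2\<close>: the last factor 2 allows
    \<open>Suc (s n)\<close> to be replaced by \<open>s n\<close> at the end.\<close>
  define \<delta> where "\<delta> = 1 / (128 * C * a\<^sup>2)"
  have \<delta>: "\<delta> > 0" unfolding \<delta>_def a_def using C by simp
  have ln1: "\<forall>\<^sub>F n :: nat in at_top. 1 \<le> ln (ln (real n))" by real_asymp
  have ln2: "\<forall>\<^sub>F n :: nat in at_top. 1 \<le> ln (real n)" by real_asymp
  \<comment> \<open>\<open>112 = 7 * 16\<close> makes the main term large enough to absorb the
    additive constants.\<close>
  have big: "\<forall>\<^sub>F n :: nat in at_top. 112 * a\<^sup>2 * ln (real n) ^ 4 \<le> real n"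
    unfolding a_def by real_asymp
  have "filterlim (\<lambda>n. \<delta> * (real n / ln (real n) ^ (c + 4))) at_top at_top"
    using \<delta> by real_asymp
  then have big2: "\<forall>\<^sub>F n :: nat in at_top. 1 \<le> \<delta> * (real n / ln (real n) ^ (c + 4))"
    by (simp add: filterlim_at_top)
  have "\<forall>\<^sub>F n in at_top. norm (real (s n)) \<ge> \<delta> * norm (real n / ln (real n) ^ (c + 4))"
    using C(2) \<alpha> ln1 ln2 big big2
  proof eventually_elim
    case (elim n)
    define X where "X = ln (real n)"
    have X: "1 \<le> X" using elim unfolding X_def by simp
    have n0: "real n > 0" using X unfolding X_def by (cases "n = 0") auto
    \<comment> \<open>Parameters: \<open>2 ^ L\<close> exceeds \<open>n\<close> because
      \<open>2 * ln 2 \<ge> 1\<close>; \<open>m\<close> is just above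
      \<open>1800 * L * Suc L\<close>, as the gap needs; \<open>m + 7\<close> leaves room for the
      wires and the hub; and \<open>N\<close> is the largest number with
      \<open>m * Suc N \<le> K\<close>.\<close>
    define L where "L = nat \<lceil>2 * X\<rceil>"
    define m where "m = 1800 * L * Suc L + 1"
    define K where "K = n div (m + 7)"
    define N where "N = K div m - 1"
    have L: "2 * X \<le> real L" "real L \<le> 3 * X"
      using X unfolding L_def by linarith+
    have m_le: "real m \<le> a * X\<^sup>2"
    proof -
      have "real m = 1800 * (real L * real (Suc L)) + 1" unfolding m_def by (simp add: algebra_simps)
      also have "\<dots> \<le> 1800 * ((3 * X) * (4 * X)) + X\<^sup>2"
        using L X by (intro add_mono mult_left_mono mult_mono) auto
      finally show ?thesis unfolding a_def by (simp add: power2_eq_square)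
    qed
    have m1: "m \<ge> 1" unfolding m_def by simp
    have mm: "real (m * (m + 7)) \<le> 8 * (a\<^sup>2 * X ^ 4)"
    proof -
      have "real (m * (m + 7)) \<le> 8 * (real m * real m)"
      proof -
        have "m * (m + 7) \<le> 8 * (m * m)" using m1 by (simp add: algebra_simps)
        then show ?thesis by (metis of_nat_le_iff of_nat_mult of_nat_numeral)
      qed
      also have "real m * real m \<le> (a * X\<^sup>2) * (a * X\<^sup>2)"
        using m_le by (intro mult_mono) (auto simp: a_def)
      finally show ?thesis by (simp add: power2_eq_square power4_eq_xxxx algebra_simps)
    qed
    have nm: "m * (m + 7) \<le> n"
    proof -
      have "8 * (a\<^sup>2 * X ^ 4) \<le> real n"
        using elim(5) zero_le_mult_iff[of "a\<^sup>2" "X ^ 4"] X unfolding X_def[symmetric] by simp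
      then show ?thesis using mm by linarith
    qed
    then have Km: "m \<le> K" unfolding K_def
      by (metis add_gr_0 less_eq_div_iff_mult_less_eq zero_less_numeral)
    \<comment> \<open>\<open>m \<le> K\<close> makes the quotient positive, so the subtraction in
      \<open>N\<close> is not truncated.\<close>
    have SN: "Suc N = K div m" unfolding N_def using Km m1 by (simp add: div_greater_zero_iff)
    have mN: "m * Suc N \<le> K" unfolding SN by (rule times_div_less_eq_dividend)
    have "N \<le> 4 * p n * Suc (s n) + 4"
    proof (rule space_lower_bound[OF alg])
      show "m > 0" "K > 0" "m * Suc N \<le> K" using m1 Km mN by simp_all
      have "real n \<le> 2 powr (2 * X)"
      proof -
        have "X = X * 1" by simp
        also have "\<dots> \<le> X * (2 * ln 2)" using X ln2_ge_two_thirds by (intro mult_left_mono) auto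
        finally have "exp X \<le> exp (2 * X * ln 2)" by simp
        then show ?thesis unfolding powr_def X_def using n0 by simp
      qed
      also have "\<dots> \<le> 2 powr real L" using L by simp
      also have "\<dots> = real (2 ^ L)" by (simp add: powr_realpow)
      finally have "n \<le> 2 ^ L" by (simp only: of_nat_le_iff)
      moreover have "K \<le> n" unfolding K_def by simp
      ultimately show "K \<le> 2 ^ L" by (rule order_trans[rotated])
      have "1 + m * K + 6 * m * Suc N \<le> 1 + m * K + 6 * K" using mN by simp
      also have "\<dots> \<le> (m + 7) * K" using Km m1 by (simp add: algebra_simps)
      also have "\<dots> \<le> n" unfolding K_def by (rule times_div_less_eq_dividend)
      finally show "1 + m * K + 6 * m * Suc N \<le> n" .
      have "\<bar>alpha n\<bar> \<le> X / ln X"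
        using elim(2,3) X unfolding X_def[symmetric] by simp
      also have "\<dots> \<le> X / 1" using elim(3) X unfolding X_def[symmetric] by (intro frac_le) auto
      also have "\<dots> \<le> real L" using L X by simp
      finally have "\<bar>alpha n\<bar> * (1800 * real (Suc L)) \<le> real L * (1800 * real (Suc L))"
        by (rule mult_right_mono) simp
      also have "\<dots> < real m" unfolding m_def by (simp add: algebra_simps)
      finally show "\<bar>alpha n\<bar> * (1800 * real (Suc L)) < real m" .
    qed
    then have "real N \<le> real (4 * p n * Suc (s n) + 4)" by (simp only: of_nat_le_iff)
    \<comment> \<open>One unit is lost to rounding in the division, the other to the
      \<open>- 1\<close> in \<open>N\<close>. The power \<open>X ^ 4\<close> reflects that
      \<open>N\<close> is about \<open>n / m ^ 2\<close> with \<open>m\<close> of order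
      \<open>X ^ 2\<close>.\<close>
    moreover have "real n / (8 * (a\<^sup>2 * X ^ 4)) - 2 \<le> real N"
    proof -
      have "K div m = n div (m * (m + 7))"
        unfolding K_def by (simp add: div_mult2_eq mult.commute[of m])
      moreover have "real n / real (m * (m + 7)) - 1 \<le> real (n div (m * (m + 7)))"
        using real_of_int_div3[of "int n" "int (m * (m + 7))"]
        by (simp flip: zdiv_int del: of_nat_mult of_nat_add)
      moreover have "real n / (8 * (a\<^sup>2 * X ^ 4)) \<le> real n / real (m * (m + 7))"
        using mm m1 by (intro frac_le) auto
      ultimately show ?thesis using SN by linarith
    qed
    moreover have "real (4 * p n * Suc (s n) + 4) = 4 * (real (p n) * real (Suc (s n))) + 4"
      by (simp add: algebra_simps)
    ultimately have "real n / (8 * (a\<^sup>2 * X ^ 4)) - 6 \<le> 4 * (real (p n) * real (Suc (s n)))"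
      by linarith
    \<comment> \<open>Half of the main term outweighs the total loss of 6, so the other half
      survives.\<close>
    moreover have "7 \<le> real n / (16 * (a\<^sup>2 * X ^ 4))"
      using elim(5) X unfolding X_def[symmetric] a_def by (simp add: field_simps)
    moreover have "real n / (8 * (a\<^sup>2 * X ^ 4)) = 2 * (real n / (16 * (a\<^sup>2 * X ^ 4)))"
      by simp
    ultimately have "real n / (16 * (a\<^sup>2 * X ^ 4)) \<le> 4 * (real (p n) * real (Suc (s n)))"
      by linarith
    also have "\<dots> \<le> 4 * ((C * X ^ c) * real (Suc (s n)))"
      using elim(1) X unfolding X_def[symmetric] by (intro mult_left_mono mult_right_mono) auto
    also have "\<dots> = real (Suc (s n)) * (4 * (C * X ^ c))"
      by (simp only: ac_simps)
    finally have "real n / (16 * (a\<^sup>2 * X ^ 4)) / (4 * (C * X ^ c)) \<le> real (Suc (s n))"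
      by (subst pos_divide_le_eq) (use C X in auto)
    also have "real n / (16 * (a\<^sup>2 * X ^ 4)) / (4 * (C * X ^ c)) = 2 * (\<delta> * (real n / X ^ (c + 4)))"
      unfolding \<delta>_def by (simp add: power_add)
    finally have "\<delta> * (real n / X ^ (c + 4)) \<le> real (s n)"
      using elim(6) unfolding X_def[symmetric] by simp
    then show ?case using X unfolding X_def[symmetric] by simp
  qed
  then have "(\<lambda>n. real (s n)) \<in> \<Omega>(\<lambda>n. real n / ln (real n) ^ (c + 4))"
    by (rule landau_omega.bigI[OF \<delta>])
  then show ?thesis by blast
qed

end
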